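(* Let $L$ be a set and let $U(L)$ be the subset of the direct sum $\ell_\infty(L)\oplus c_0(L)$ consisting of all pairs $(f,x)$ such that $\|f\|_\infty$ and $\|x\|_\infty$ are both strictly less than $\bigl\||f|+\tfrac12|x|\bigr\|_\infty$. The space $\ell_\infty(L)\oplus c_0(L)$ admits an equivalent norm $\|\cdot\|$ with the following properties: (1) $\|\cdot\|$ is a lattice norm, in the sense that $\|(g,y)\|\le\|(f,x)\|$ whenever $|g|\le|f|$ and $|y|\le|x|$ (coordinatewise); (2) $\|\cdot\|$ is infinitely differentiable on the open set $U(L)$; (3) locally on $U(L)$, $\|(f,x)\|$ depends on only finitely many non-zero coordinates; that is to say, for each $(f^0,x^0)\in U(L)$ there is a finite $N\subseteq L$ and an open neighbourhood $V$ of $(f^0,x^0)$ in $U(L)$ such that for $(f,x)\in V$ the norm $\|(f,x)\|$ is determined by the values of $f_t$ and $x_t$ with $t\in N$, and such that $f_t\neq0$ and $x_t\neq0$ for all $(f,x)\in V$ and all $t\in N$.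
   Context: All spaces are real. $\ell_\infty(L)$ is the space of bounded real-valued functions $f=(f_t)_{t\in L}$ on $L$ with the supremum norm $\|\cdot\|_\infty$; $c_0(L)$ is its closed subspace of those $x=(x_t)_{t\in L}$ such that $\{t\in L:|x_t|\ge\epsilon\}$ is finite for every $\epsilon>0$. $|f|$ denotes the coordinatewise absolute value $(|f_t|)_{t\in L}$. The direct sum carries its usual product Banach space topology (e.g. from the norm $\|f\|_\infty+\|x\|_\infty$), and "equivalent norm" means equivalent to this one. Differentiability is in the Fréchet sense. *)

theory Defs
  imports "HOL-Analysis.Analysis" "HOL-Probability.Discrete_Topology"
begin

text \<open>
  Every function on a discrete space is continuous, so \<open>'l discrete \<Rightarrow>\<^sub>C real\<close> is the Banach space
  of all bounded real functions on \<open>'l\<close> with the supremum norm. For a set \<open>L :: 'l set\<close> (possibly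
  empty), the functions on \<open>L\<close> are represented by their extensions by zero; thus the spaces
  over \<open>L\<close> are subspaces of \<open>'l discrete \<Rightarrow>\<^sub>C real\<close>, with the inherited norm.
\<close>

abbreviation coord :: "('l discrete \<Rightarrow>\<^sub>C real) \<Rightarrow> 'l \<Rightarrow> real" where
  "coord f t \<equiv> apply_bcontfun f (discrete t)"

definition ell_infty :: "'l set \<Rightarrow> ('l discrete \<Rightarrow>\<^sub>C real) set" where
  "ell_infty L = {f. \<forall>t. t \<notin> L \<longrightarrow> coord f t = 0}"

definition c_zero :: "'l set \<Rightarrow> ('l discrete \<Rightarrow>\<^sub>C real) set" where
  "c_zero L = {x \<in> ell_infty L. \<forall>e>0. finite {t \<in> L. \<bar>coord x t\<bar> \<ge> e}}"

text \<open>
  The norm of the product type is \<open>sqrt ((norm f)\<^sup>2 + (norm x)\<^sup>2)\<close>; it induces the product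
  topology and is equivalent to \<open>norm f + norm x\<close>.
\<close>

definition direct_sum :: "'l set \<Rightarrow> (('l discrete \<Rightarrow>\<^sub>C real) \<times> ('l discrete \<Rightarrow>\<^sub>C real)) set" where
  "direct_sum L = ell_infty L \<times> c_zero L"

text \<open>
  The supremum below may be taken over the whole type, because the terms are nonnegative and vanish
  off \<open>L\<close>; for empty \<open>L\<close> it is \<open>0\<close>.
\<close>

definition U_set :: "'l set \<Rightarrow> (('l discrete \<Rightarrow>\<^sub>C real) \<times> ('l discrete \<Rightarrow>\<^sub>C real)) set" where
  "U_set L = {(f, x) \<in> direct_sum L.
     norm f < (SUP t. \<bar>coord f t\<bar> + \<bar>coord x t\<bar> / 2) \<and>
     norm x < (SUP t. \<bar>coord f t\<bar> + \<bar>coord x t\<bar> / 2)}"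

definition norm_on :: "'a::real_vector set \<Rightarrow> ('a \<Rightarrow> real) \<Rightarrow> bool" where
  "norm_on E p \<longleftrightarrow>
     (\<forall>x\<in>E. 0 \<le> p x \<and> (p x = 0 \<longleftrightarrow> x = 0)) \<and>
     (\<forall>x\<in>E. \<forall>a. p (a *\<^sub>R x) = \<bar>a\<bar> * p x) \<and>
     (\<forall>x\<in>E. \<forall>y\<in>E. p (x + y) \<le> p x + p y)"

definition equivalent_norm_on :: "'a::real_normed_vector set \<Rightarrow> ('a \<Rightarrow> real) \<Rightarrow> bool" where
  "equivalent_norm_on E p \<longleftrightarrow> norm_on E p \<and>
     (\<exists>c>0. \<exists>C>0. \<forall>x\<in>E. c * norm x \<le> p x \<and> p x \<le> C * norm x)"

text \<open>
  A \<open>k\<close>-linear map on a subspace \<open>E\<close> is encoded as a function of lists over \<open>E\<close> of length \<open>k\<close>.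
  This allows derivatives of all orders to have the same type.
\<close>

definition bounded_multilinear_on ::
    "'a::real_normed_vector set \<Rightarrow> nat \<Rightarrow> ('a list \<Rightarrow> 'b::real_normed_vector) \<Rightarrow> bool" where
  "bounded_multilinear_on E k M \<longleftrightarrow>
     (\<forall>us\<in>lists E. \<forall>ws\<in>lists E. length us + Suc (length ws) = k \<longrightarrow>
        (\<forall>u\<in>E. \<forall>v\<in>E. M (us @ (u + v) # ws) = M (us @ u # ws) + M (us @ v # ws)) \<and>
        (\<forall>u\<in>E. \<forall>a. M (us @ (a *\<^sub>R u) # ws) = a *\<^sub>R M (us @ u # ws))) \<and>
     (\<exists>C. \<forall>vs\<in>lists E. length vs = k \<longrightarrow> norm (M vs) \<le> C * prod_list (map norm vs))"

text \<open>
  Infinite Frechet differentiability on a relatively open subset \<open>U\<close> of a subspace \<open>E\<close>: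
  \<open>D k x\<close> is the \<open>k\<close>-th derivative at \<open>x\<close>, a bounded \<open>k\<close>-linear map on \<open>E\<close>, and \<open>D k\<close> is Frechet
  differentiable at \<open>x\<close> with respect to the operator norm on bounded \<open>k\<close>-linear maps, its
  derivative being \<open>h \<mapsto> D (Suc k) x (h # _)\<close>. The last estimate bounds the operator norm of
  \<open>D k y - D k x - D (Suc k) x ((y - x) # _)\<close> by \<open>e * norm (y - x)\<close>.
\<close>

definition frechet_smooth_on ::
    "'a::real_normed_vector set \<Rightarrow> 'a set \<Rightarrow> ('a \<Rightarrow> 'b::real_normed_vector) \<Rightarrow> bool" where
  "frechet_smooth_on E U f \<longleftrightarrow> openin (top_of_set E) U \<and>
     (\<exists>D :: nat \<Rightarrow> 'a \<Rightarrow> 'a list \<Rightarrow> 'b.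
        (\<forall>x\<in>U. D 0 x [] = f x) \<and>
        (\<forall>k. \<forall>x\<in>U. bounded_multilinear_on E k (D k x)) \<and>
        (\<forall>k. \<forall>x\<in>U. \<forall>e>0. \<exists>d>0. \<forall>y\<in>U. norm (y - x) < d \<longrightarrow>
           (\<forall>vs\<in>lists E. length vs = k \<longrightarrow>
              norm (D k y vs - D k x vs - D (Suc k) x ((y - x) # vs))
                \<le> e * norm (y - x) * prod_list (map norm vs))))"

end

theory Submission
  imports Defs
begin

text \<open>
  The norm must be a smooth substitute for \<open>mixed_sup (f, x) = (SUP t. \<bar>f t\<bar> + \<bar>x t\<bar> / 2)\<close>. On
  \<open>U_set L\<close> this supremum exceeds \<open>norm f\<close>, so that \<open>x t\<close> is bounded away from zero wherever the
  sum is close to it; as \<open>x \<in> c_zero L\<close>, there are only finitely many such \<open>t\<close>. It also exceeds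
  \<open>norm x\<close>, and so \<open>f t\<close> is bounded away from zero there as well. But the gap between the
  supremum and \<open>norm f\<close> can be arbitrarily small, and a smooth norm of fixed precision would blur
  it and depend on infinitely many coordinates.

  The remedy is to use infinitely many precisions at once. For each \<open>k\<close>, \<open>level k t\<close> is a
  slightly modified sum \<open>(1 - 4 ^ -(k+1)) \<bar>f t\<bar> + (1/2 + 2 ^ -(k+1)) \<bar>x t\<bar>\<close>, and it may exceed the
  norm by a factor of at most \<open>1 + 4 ^ -(k+1)\<close>, which is enforced by a smooth convex function
  \<open>penalty k\<close> vanishing on \<open>r \<le> 1\<close>. The norm is the least \<open>r\<close> with
  \<open>(\<Sum>k t. penalty k (level k t / r)) \<le> 1\<close>; it is a lattice norm as the gauge of a convex, solid set.
  Where \<open>x t\<close> is bounded away from zero, the gain \<open>2 ^ -(k+1) \<bar>x t\<bar>\<close> outweighs both the loss and the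
  tolerance, which are of order \<open>4 ^ -(k+1)\<close>, once \<open>k\<close> is large. Hence \<open>mixed_sup z < lattice_norm z\<close>
  on \<open>U_set L\<close> (\<open>mixed_sup_less_lattice_norm\<close>). On the other hand, only finitely many levels exceed
  a given number above \<open>mixed_sup z\<close> (\<open>finite_active\<close>), because levels are at most
  \<open>mixed_sup z + 2 ^ -(k+1) \<bar>x t\<bar>\<close>.

  So near a point of \<open>U_set L\<close> the norm is defined by an equation
  \<open>(\<Sum>(k, t)\<in>J. penalty k (level k t z / lattice_norm z)) = 1\<close> with one finite \<open>J\<close>, in which all coordinates
  that occur are nonzero (\<open>local_description\<close>), and hence each level is linear. This gives the local
  dependence on finitely many coordinates. Smoothness is implicit differentiation
  (\<open>implicit_gauge_smooth\<close>): the first derivatives of the norm are algebraic expressions in the norm,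
  in linear functionals and in flat functions of these, and so are, therefore, the derivatives of
  all orders.
\<close>

section \<open>Flat functions\<close>

text \<open>
  Differentiation maps each of these functions to a linear combination of two others, so that all
  derivatives of \<open>smooth_hinge\<close> below are combinations of them.
\<close>

definition flat :: "nat \<Rightarrow> real \<Rightarrow> real" where
  "flat n r = (if r \<le> 0 then 0 else (1 / r) ^ n * exp (- (1 / r)))"

lemma flat_nonneg: "0 \<le> flat n r"
  by (simp add: flat_def)

lemma flat_pos: "0 < r \<Longrightarrow> 0 < flat n r"
  by (simp add: flat_def)

lemma flat_nonpos_arg: "r \<le> 0 \<Longrightarrow> flat n r = 0"
  by (simp add: flat_def)

lemma mult_flat_Suc: "r * flat (Suc n) r = flat n r"
  by (simp add: flat_def)

lemma flat_tendsto_0: "(flat n \<longlongrightarrow> 0) (at 0)"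
proof -
  have "((\<lambda>r. (inverse r) ^ n / exp (inverse r)) \<longlongrightarrow> (0::real)) (at_right 0)"
    by (rule filterlim_compose[OF tendsto_power_div_exp_0 filterlim_inverse_at_top_right])
  then have R: "(flat n \<longlongrightarrow> 0) (at_right 0)"
    by (rule Lim_transform_eventually)
       (auto simp: flat_def eventually_at_filter exp_minus field_simps)
  have L: "(flat n \<longlongrightarrow> 0) (at_left 0)"
    by (rule Lim_transform_eventually[OF tendsto_const])
       (auto simp: flat_def eventually_at_filter)
  show ?thesis
    using filterlim_split_at[OF L R] .
qed

lemma flat_deriv:
  "(flat n has_real_derivative (flat (n + 2) r - real n * flat (n + 1) r)) (at r)"
proof -
  consider "r > 0" | "r < 0" | "r = 0" by linarith
  then show ?thesis
  proof cases
    case 1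
    have "((\<lambda>r. (1 / r) ^ n * exp (- (1 / r))) has_real_derivative
        (flat (n + 2) r - real n * flat (n + 1) r)) (at r)"
    proof -
      have D: "((\<lambda>r. 1 / r) has_real_derivative - ((1 / r) * (1 / r))) (at r)"
        using 1 by (auto intro!: derivative_eq_intros simp: field_simps power2_eq_square)
      have E: "((\<lambda>r. exp (- (1 / r))) has_real_derivative
          exp (- (1 / r)) * ((1 / r) * (1 / r))) (at r)"
        using DERIV_fun_exp[OF DERIV_minus[OF D]] by simp
      show ?thesis
        using DERIV_mult[OF DERIV_power[OF D, of n] E] 1
        by (cases n) (simp_all add: flat_def algebra_simps)
    qed
    then show ?thesis
      by (rule has_field_derivative_transform_within_open[where S = "{0<..}"])
         (use 1 in \<open>auto simp: flat_def\<close>)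
  next
    case 2
    have "((\<lambda>r. 0) has_real_derivative (flat (n + 2) r - real n * flat (n + 1) r)) (at r)"
      using 2 by (simp add: flat_def)
    then show ?thesis
      by (rule has_field_derivative_transform_within_open[where S = "{..<0}"])
         (use 2 in \<open>auto simp: flat_def\<close>)
  next
    case 3
    have "((\<lambda>h. (flat n (0 + h) - flat n 0) / h) \<longlongrightarrow> 0) (at 0)"
      by (rule Lim_transform_eventually[OF flat_tendsto_0[of "Suc n"]])
         (auto simp: flat_def eventually_at_filter)
    then show ?thesis
      using 3 by (simp add: DERIV_def flat_def)
  qed
qed

text \<open>
  The factor \<open>r\<close> makes the flat function \<open>exp (- 1 / r)\<close> convex on the whole line: the
  second derivative is \<open>exp (- 1 / r) / r ^ 3\<close>.
\<close>

definition smooth_hinge :: "real \<Rightarrow> real" where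
  "smooth_hinge r = r * flat 0 r"

definition smooth_hinge' :: "real \<Rightarrow> real" where
  "smooth_hinge' r = flat 0 r + flat 1 r"

lemma smooth_hinge_deriv: "(smooth_hinge has_real_derivative smooth_hinge' r) (at r)"
proof -
  have "((\<lambda>r. r * flat 0 r) has_real_derivative smooth_hinge' r) (at r)"
    using mult_flat_Suc[of r 1]
    by (auto intro!: derivative_eq_intros flat_deriv simp: smooth_hinge'_def numeral_2_eq_2 mult.commute)
  then show ?thesis
    by (simp add: smooth_hinge_def[abs_def])
qed

lemma smooth_hinge'_nonneg: "0 \<le> smooth_hinge' r"
  by (simp add: smooth_hinge'_def flat_nonneg)

lemma smooth_hinge'_pos: "0 < r \<Longrightarrow> 0 < smooth_hinge' r"
  by (simp add: smooth_hinge'_def flat_pos add_pos_pos)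

lemma smooth_hinge'_eq_0: "r \<le> 0 \<Longrightarrow> smooth_hinge' r = 0"
  by (simp add: smooth_hinge'_def flat_nonpos_arg)

lemma smooth_hinge_eq_0: "r \<le> 0 \<Longrightarrow> smooth_hinge r = 0"
  by (simp add: smooth_hinge_def flat_nonpos_arg)

lemma smooth_hinge_pos: "0 < r \<Longrightarrow> 0 < smooth_hinge r"
  by (simp add: smooth_hinge_def flat_pos)

lemma smooth_hinge_nonneg: "0 \<le> smooth_hinge r"
  by (cases "r \<le> 0") (auto simp: smooth_hinge_eq_0 less_imp_le smooth_hinge_pos)

lemma smooth_hinge_mono: "r \<le> s \<Longrightarrow> smooth_hinge r \<le> smooth_hinge s"
  by (rule DERIV_nonneg_imp_nondecreasing) (use smooth_hinge_deriv smooth_hinge'_nonneg in blast)+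

lemma smooth_hinge_strict_mono:
  assumes "r < s" "0 < s"
  shows "smooth_hinge r < smooth_hinge s"
proof (cases "r \<le> 0")
  case False
  show ?thesis
  proof (rule DERIV_pos_imp_increasing[OF assms(1)])
    fix x assume "r \<le> x"
    then have "0 < smooth_hinge' x" using False by (intro smooth_hinge'_pos) simp
    then show "\<exists>y. (smooth_hinge has_real_derivative y) (at x) \<and> 0 < y"
      using smooth_hinge_deriv by blast
  qed
qed (use assms in \<open>simp add: smooth_hinge_eq_0 smooth_hinge_pos\<close>)

lemma convex_smooth_hinge: "convex_on UNIV smooth_hinge"
proof (rule f''_ge0_imp_convex[where f' = smooth_hinge' and f'' = "flat 3"])
  show "(smooth_hinge' has_real_derivative flat 3 r) (at r)" for r
    unfolding smooth_hinge'_def[abs_def]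
    using DERIV_add[OF flat_deriv[of 0] flat_deriv[of 1]] by (simp add: numeral_3_eq_3 numeral_2_eq_2)
qed (auto simp: smooth_hinge_deriv flat_nonneg)

lemma isCont_smooth_hinge: "isCont smooth_hinge r"
  using smooth_hinge_deriv DERIV_isCont by blast

section \<open>Smoothness from algebras closed under partial derivatives\<close>

text \<open>
  Every derivative of a member \<open>g\<close> of such a class is a finite sum of members, multiplied by products
  of the functionals \<open>l j\<close>. This reduces smoothness of \<open>g\<close> to statements on first derivatives.
\<close>

locale closed_under_partials =
  fixes V :: "'a::real_normed_vector set"
    and J :: "'j set"
    and l :: "'j \<Rightarrow> 'a \<Rightarrow> real"
    and A :: "('a \<Rightarrow> real) set"
    and P :: "('a \<Rightarrow> real) \<Rightarrow> 'j \<Rightarrow> 'a \<Rightarrow> real"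
  assumes finite_J: "finite J"
    and lin: "j \<in> J \<Longrightarrow> bounded_linear (l j)"
    and P_in: "g \<in> A \<Longrightarrow> j \<in> J \<Longrightarrow> P g j \<in> A"
    and P_deriv: "g \<in> A \<Longrightarrow> x \<in> V \<Longrightarrow>
      (g has_derivative (\<lambda>h. \<Sum>j\<in>J. P g j x * l j h)) (at x within V)"
begin

text \<open>
  The derivative of order \<open>length vs\<close>, in the directions \<open>vs\<close>. The first entry of \<open>vs\<close> is the
  direction in which \<open>g\<close> is differentiated first; this is the opposite of the order in
  \<open>frechet_smooth_on\<close>, where the newest direction comes first.
\<close>

primrec nderiv :: "('a \<Rightarrow> real) \<Rightarrow> 'a list \<Rightarrow> 'a \<Rightarrow> real" where
  "nderiv g [] x = g x"
| "nderiv g (v # vs) x = (\<Sum>j\<in>J. nderiv (P g j) vs x * l j v)"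

lemma nderiv_Nil: "nderiv g [] = g"
  by (rule ext) simp

lemma has_derivative_nderiv:
  assumes "x \<in> V"
  shows "g \<in> A \<Longrightarrow> (nderiv g vs has_derivative (\<lambda>h. nderiv g (vs @ [h]) x)) (at x within V)"
proof (induction vs arbitrary: g)
  case Nil
  then show ?case using P_deriv[OF Nil assms] by (simp add: nderiv_Nil)
next
  case (Cons v vs)
  have "((\<lambda>y. \<Sum>j\<in>J. nderiv (P g j) vs y * l j v) has_derivative
      (\<lambda>h. \<Sum>j\<in>J. nderiv (P g j) (vs @ [h]) x * l j v)) (at x within V)"
    by (intro has_derivative_sum has_derivative_mult_left Cons.IH P_in Cons.prems)
  then show ?case by simp
qed

lemma nderiv_add:
  "nderiv g (us @ (u + v) # ws) x = nderiv g (us @ u # ws) x + nderiv g (us @ v # ws) x"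
proof (induction us arbitrary: g)
  case Nil
  show ?case
    by (simp add: linear_add[OF bounded_linear.linear[OF lin]] ring_distribs sum.distrib)
qed (simp add: ring_distribs sum.distrib)

lemma nderiv_scaleR: "nderiv g (us @ (a *\<^sub>R u) # ws) x = a *\<^sub>R nderiv g (us @ u # ws) x"
proof (induction us arbitrary: g)
  case Nil
  show ?case
    by (simp add: linear_scale[OF bounded_linear.linear[OF lin]] sum_distrib_left mult.left_commute)
qed (simp add: sum_distrib_left mult.assoc)

lemma common_bound: "\<exists>K>0. \<forall>j\<in>J. \<forall>v. \<bar>l j v\<bar> \<le> K * norm v"
proof -
  have "\<forall>j\<in>J. \<exists>K. \<forall>v. \<bar>l j v\<bar> \<le> K * norm v"
    using bounded_linear.bounded[OF lin] by (metis mult.commute real_norm_def)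
  then obtain K where K: "\<forall>j\<in>J. \<forall>v. \<bar>l j v\<bar> \<le> K j * norm v" by metis
  define B where "B = 1 + (\<Sum>j\<in>J. \<bar>K j\<bar>)"
  have "\<bar>l j v\<bar> \<le> B * norm v" if "j \<in> J" for j v
  proof -
    have "K j \<le> B"
      using member_le_sum[of j J "\<lambda>j. \<bar>K j\<bar>"] that finite_J by (auto simp: B_def)
    then show ?thesis
      using K that by (meson mult_right_mono norm_ge_zero order_trans)
  qed
  moreover have "B > 0" by (auto simp: B_def intro: add_pos_nonneg sum_nonneg)
  ultimately show ?thesis by blast
qed

lemma nderiv_bounded:
  "\<exists>C. \<forall>vs. length vs = k \<longrightarrow> \<bar>nderiv g vs x\<bar> \<le> C * prod_list (map norm vs)"
proof (induction k arbitrary: g)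
  case 0
  show ?case by (intro exI[of _ "\<bar>g x\<bar>"]) simp
next
  case (Suc k)
  obtain K where K: "K > 0" "\<And>j v. j \<in> J \<Longrightarrow> \<bar>l j v\<bar> \<le> K * norm v" using common_bound by blast
  have "\<forall>j. \<exists>C. \<forall>vs. length vs = k \<longrightarrow> \<bar>nderiv (P g j) vs x\<bar> \<le> C * prod_list (map norm vs)"
    using Suc by blast
  then obtain C where
    C: "\<And>j vs. length vs = k \<Longrightarrow> \<bar>nderiv (P g j) vs x\<bar> \<le> C j * prod_list (map norm vs)"
    by metis
  have "\<bar>nderiv g vs x\<bar> \<le> (\<Sum>j\<in>J. \<bar>C j\<bar> * K) * prod_list (map norm vs)" if len: "length vs = Suc k" for vs
  proof -
    obtain w ws where vs: "vs = w # ws" "length ws = k" using len by (cases vs) auto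
    have nn: "0 \<le> prod_list (map norm ws)" by (induction ws) auto
    have "\<bar>nderiv g vs x\<bar> \<le> (\<Sum>j\<in>J. \<bar>nderiv (P g j) ws x\<bar> * \<bar>l j w\<bar>)"
      using sum_abs[of "\<lambda>j. nderiv (P g j) ws x * l j w" J] by (simp add: vs abs_mult)
    also have "\<dots> \<le> (\<Sum>j\<in>J. (\<bar>C j\<bar> * prod_list (map norm ws)) * (K * norm w))"
    proof (intro sum_mono mult_mono)
      show "\<bar>nderiv (P g j) ws x\<bar> \<le> \<bar>C j\<bar> * prod_list (map norm ws)" for j
        using C[OF vs(2), of j] nn by (meson abs_ge_self mult_right_mono order_trans)
    qed (use K nn in auto)
    also have "\<dots> = (\<Sum>j\<in>J. \<bar>C j\<bar> * K) * prod_list (map norm vs)"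
      by (simp add: vs sum_distrib_right sum_distrib_left algebra_simps)
    finally show ?thesis .
  qed
  then show ?case by blast
qed

text \<open>
  The derivative of \<open>nderiv g\<close> in the sense of the operator norm: the error is uniform in the
  directions, because each of these enters only through the finitely many numbers \<open>l j v\<close>.
\<close>

lemma nderiv_uniform_derivative:
  assumes x: "x \<in> V"
  shows "g \<in> A \<Longrightarrow> e > 0 \<Longrightarrow> \<forall>\<^sub>F y in at x within V. \<forall>vs. length vs = k \<longrightarrow>
    \<bar>nderiv g vs y - nderiv g vs x - nderiv g (vs @ [y - x]) x\<bar>
      \<le> e * norm (y - x) * prod_list (map norm vs)"
proof (induction k arbitrary: g e)
  case 0
  from P_deriv[OF 0(1) x] 0(2) obtain d where "d > 0"
    "\<forall>y\<in>V. norm (y - x) < d \<longrightarrow>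
      norm (g y - g x - (\<Sum>j\<in>J. P g j x * l j (y - x))) \<le> e * norm (y - x)"
    unfolding has_derivative_within_alt by blast
  then show ?case
    unfolding eventually_at by (intro exI[of _ d]) (auto simp: dist_norm)
next
  case (Suc k)
  obtain K where K: "K > 0" "\<And>j v. j \<in> J \<Longrightarrow> \<bar>l j v\<bar> \<le> K * norm v" using common_bound by blast
  \<comment> \<open>Each of the \<open>card J\<close> partial derivatives contributes an error of at most \<open>e' * K\<close>; the
    \<open>1\<close> keeps \<open>e'\<close> positive for empty \<open>J\<close>.\<close>
  define e' where "e' = e / (K * (1 + card J))"
  have e': "e' > 0" using Suc.prems K by (simp add: e'_def)
  have e'_le: "card J * (e' * K) \<le> e"
    using K(1) Suc.prems by (simp add: e'_def divide_simps)
  have "\<forall>\<^sub>F y in at x within V. \<forall>j\<in>J. \<forall>vs. length vs = k \<longrightarrow>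
    \<bar>nderiv (P g j) vs y - nderiv (P g j) vs x - nderiv (P g j) (vs @ [y - x]) x\<bar>
      \<le> e' * norm (y - x) * prod_list (map norm vs)"
    by (intro eventually_ball_finite finite_J ballI Suc.IH P_in Suc.prems e')
  then show ?case
  proof (rule eventually_mono, intro allI impI)
    fix y vs
    assume y: "\<forall>j\<in>J. \<forall>vs. length vs = k \<longrightarrow>
        \<bar>nderiv (P g j) vs y - nderiv (P g j) vs x - nderiv (P g j) (vs @ [y - x]) x\<bar>
        \<le> e' * norm (y - x) * prod_list (map norm vs)"
      and len: "length (vs :: 'a list) = Suc k"
    obtain w ws where vs: "vs = w # ws" "length ws = k" using len by (cases vs) auto
    have nn: "0 \<le> prod_list (map norm ws)" by (induction ws) auto
    let ?r = "\<lambda>j. nderiv (P g j) ws y - nderiv (P g j) ws x - nderiv (P g j) (ws @ [y - x]) x"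
    have eq: "nderiv g vs y - nderiv g vs x - nderiv g (vs @ [y - x]) x = (\<Sum>j\<in>J. ?r j * l j w)"
      by (simp add: vs sum_subtractf left_diff_distrib)
    have "\<bar>nderiv g vs y - nderiv g vs x - nderiv g (vs @ [y - x]) x\<bar>
        \<le> (\<Sum>j\<in>J. \<bar>?r j\<bar> * \<bar>l j w\<bar>)"
      unfolding eq abs_mult[symmetric] by (rule sum_abs)
    also have "\<dots> \<le> (\<Sum>j\<in>J. (e' * norm (y - x) * prod_list (map norm ws)) * (K * norm w))"
    proof (intro sum_mono mult_mono)
      show "\<bar>?r j\<bar> \<le> e' * norm (y - x) * prod_list (map norm ws)" if "j \<in> J" for j
        using y that vs(2) by blast
    qed (use K e' nn in auto)
    also have "\<dots> = card J * (e' * K) * (norm (y - x) * prod_list (map norm vs))"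
      by (simp add: vs algebra_simps)
    also have "\<dots> \<le> e * (norm (y - x) * prod_list (map norm vs))"
      using nn by (intro mult_right_mono e'_le) (auto simp: vs)
    finally show "\<bar>nderiv g vs y - nderiv g vs x - nderiv g (vs @ [y - x]) x\<bar>
        \<le> e * norm (y - x) * prod_list (map norm vs)" by (simp add: mult.assoc)
  qed
qed

end

text \<open>
  Iterated directional derivatives are determined by the function alone. They allow smoothness to
  be proved locally: the classes of functions used around different points need not be compatible.
\<close>

primrec iterated_dderiv :: "('a::real_normed_vector \<Rightarrow> real) \<Rightarrow> 'a list \<Rightarrow> 'a \<Rightarrow> real" where
  "iterated_dderiv f [] x = f x"
| "iterated_dderiv f (h # vs) x = deriv (\<lambda>s. iterated_dderiv f vs (x + s *\<^sub>R h)) 0"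

lemma (in closed_under_partials) iterated_dderiv_eq_nderiv:
  assumes E: "subspace E" and V: "openin (top_of_set E) V" and p: "p \<in> A"
  shows "x \<in> V \<Longrightarrow> vs \<in> lists E \<Longrightarrow> iterated_dderiv p vs x = nderiv p (rev vs) x"
proof (induction vs arbitrary: x)
  case Nil
  then show ?case by simp
next
  case (Cons h vs)
  have h: "h \<in> E" and vs: "vs \<in> lists E" using Cons.prems by auto
  obtain T where T: "open T" "V = E \<inter> T" using V by (auto simp: openin_open)
  define S where "S = {s. x + s *\<^sub>R h \<in> T}"
  have "open S"
    unfolding S_def using T(1) by (rule open_vimage[unfolded vimage_def]) (intro continuous_intros)
  have S0: "0 \<in> S" using Cons.prems T by (auto simp: S_def)
  have SV: "x + s *\<^sub>R h \<in> V" if "s \<in> S" for s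
    using that Cons.prems T h E by (auto simp: S_def subspace_add subspace_scale)
  have line: "((\<lambda>s. x + s *\<^sub>R h) has_derivative (\<lambda>s. s *\<^sub>R h)) (at 0 within S)"
    by (rule derivative_eq_intros refl)+ simp
  have "(nderiv p (rev vs) has_derivative (\<lambda>h. nderiv p (rev vs @ [h]) x)) (at x within V)"
    by (rule has_derivative_nderiv[OF Cons.prems(1) p])
  then have "(nderiv p (rev vs) has_derivative (\<lambda>h. nderiv p (rev vs @ [h]) x))
      (at x within (\<lambda>s. x + s *\<^sub>R h) ` S)"
    by (rule has_derivative_subset) (use SV in blast)
  then have "((\<lambda>s. nderiv p (rev vs) (x + s *\<^sub>R h)) has_derivative
      (\<lambda>s. nderiv p (rev vs @ [s *\<^sub>R h]) x)) (at 0 within S)"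
    using has_derivative_in_compose[OF line, of "nderiv p (rev vs)"] by simp
  then have "((\<lambda>s. nderiv p (rev vs) (x + s *\<^sub>R h)) has_derivative
      (\<lambda>s. nderiv p (rev vs @ [s *\<^sub>R h]) x)) (at 0)"
    by (simp only: at_within_open[OF S0 \<open>open S\<close>])
  then have D: "((\<lambda>s. nderiv p (rev vs) (x + s *\<^sub>R h)) has_real_derivative
      nderiv p (rev vs @ [h]) x) (at 0)"
    by (simp add: has_field_derivative_def nderiv_scaleR mult.commute[of _ "nderiv _ _ _"])
  have "((\<lambda>s. iterated_dderiv p vs (x + s *\<^sub>R h)) has_real_derivative
      nderiv p (rev vs @ [h]) x) (at 0)"
    by (rule has_field_derivative_transform_within_open[OF D \<open>open S\<close> S0])
       (simp add: Cons.IH SV vs)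
  then show ?case by (simp add: DERIV_imp_deriv)
qed

lemma frechet_smooth_onI:
  fixes p :: "'a::real_normed_vector \<Rightarrow> real"
  assumes E: "subspace E" and U: "openin (top_of_set E) U"
    and loc: "\<And>x. x \<in> U \<Longrightarrow> \<exists>V (J :: 'j set) l A P. openin (top_of_set E) V \<and> x \<in> V \<and>
      closed_under_partials V J l A P \<and> p \<in> A"
  shows "frechet_smooth_on E U p"
proof -
  let ?D = "\<lambda>k x vs. iterated_dderiv p vs x"
  have multi: "bounded_multilinear_on E k (?D k x)" if "x \<in> U" for k x
  proof -
    from loc[OF that] obtain V and J :: "'j set" and l A P
      where V: "openin (top_of_set E) V" "x \<in> V" and cl: "closed_under_partials V J l A P"
        and p: "p \<in> A" by blast
    interpret closed_under_partials V J l A P by (rule cl)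
    have eq: "iterated_dderiv p vs x = nderiv p (rev vs) x" if "vs \<in> lists E" for vs
      by (rule iterated_dderiv_eq_nderiv[OF E V(1) p V(2) that])
    obtain C where C: "\<And>vs. length vs = k \<Longrightarrow> \<bar>nderiv p vs x\<bar> \<le> C * prod_list (map norm vs)"
      using nderiv_bounded by blast
    have rev: "prod_list (map norm (rev vs)) = prod_list (map norm vs)" for vs :: "'a list"
      by (simp add: rev_map[symmetric] prod_list.rev)
    have "\<forall>vs\<in>lists E. length vs = k \<longrightarrow> norm (?D k x vs) \<le> C * prod_list (map norm vs)"
      using C[of "rev _"] by (auto simp: eq rev)
    then show ?thesis
      unfolding bounded_multilinear_on_def
      using E by (auto simp: eq nderiv_add nderiv_scaleR subspace_add subspace_scale simp del: real_scaleR_def)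
  qed
  have der: "\<exists>d>0. \<forall>y\<in>U. norm (y - x) < d \<longrightarrow> (\<forall>vs\<in>lists E. length vs = k \<longrightarrow>
      norm (?D k y vs - ?D k x vs - ?D (Suc k) x ((y - x) # vs))
        \<le> e * norm (y - x) * prod_list (map norm vs))"
    if x: "x \<in> U" and e: "e > 0" for x k and e :: real
  proof -
    from loc[OF x] obtain V and J :: "'j set" and l A P
      where V: "openin (top_of_set E) V" "x \<in> V" and cl: "closed_under_partials V J l A P"
        and p: "p \<in> A" by blast
    interpret closed_under_partials V J l A P by (rule cl)
    have eq: "iterated_dderiv p vs z = nderiv p (rev vs) z" if "z \<in> V" "vs \<in> lists E" for vs z
      by (rule iterated_dderiv_eq_nderiv[OF E V(1) p that])
    from nderiv_uniform_derivative[OF V(2) p e, of k]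
    obtain d where d: "d > 0" "\<And>y vs. y \<in> V \<Longrightarrow> y \<noteq> x \<Longrightarrow> norm (y - x) < d \<Longrightarrow> length vs = k \<Longrightarrow>
      \<bar>nderiv p vs y - nderiv p vs x - nderiv p (vs @ [y - x]) x\<bar>
        \<le> e * norm (y - x) * prod_list (map norm vs)"
      unfolding eventually_at by (auto simp: dist_norm)
    obtain d' where d': "d' > 0" "\<And>y. y \<in> E \<Longrightarrow> norm (y - x) < d' \<Longrightarrow> y \<in> V"
      using V by (auto simp: openin_euclidean_subtopology_iff dist_norm)
    have UE: "U \<subseteq> E" using U by (rule openin_imp_subset)
    have rev: "prod_list (map norm (rev vs)) = prod_list (map norm vs)" for vs :: "'a list"
      by (simp add: rev_map[symmetric] prod_list.rev)
    have "norm (?D k y vs - ?D k x vs - ?D (Suc k) x ((y - x) # vs))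
        \<le> e * norm (y - x) * prod_list (map norm vs)"
      if y: "y \<in> U" "norm (y - x) < min d d'" and vs: "vs \<in> lists E" "length vs = k" for y vs
    proof -
      have yV: "y \<in> V" using y UE d' by auto
      have yx: "y - x \<in> E" using y x UE E by (meson subsetD subspace_diff)
      show ?thesis
      proof (cases "y = x")
        case True
        then show ?thesis
          using nderiv_scaleR[of p "rev vs" 0 0 "[]" x] vs V yx by (subst (3) eq) auto
      next
        case False
        then show ?thesis
          using d(2)[OF yV False, of "rev vs"] y vs V yx yV by (simp add: eq rev del: iterated_dderiv.simps(2))
      qed
    qed
    then show ?thesis using d d' by (intro exI[of _ "min d d'"]) auto
  qed
  show ?thesis
    unfolding frechet_smooth_on_def
    using U multi der by (intro conjI exI[of _ ?D]) (simp_all del: iterated_dderiv.simps(2))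
qed

inductive_set function_algebra :: "'a set \<Rightarrow> ('a \<Rightarrow> real) set \<Rightarrow> ('a \<Rightarrow> real) set" for V B where
  base: "g \<in> B \<Longrightarrow> g \<in> function_algebra V B"
| const: "(\<lambda>x. c) \<in> function_algebra V B"
| add: "f \<in> function_algebra V B \<Longrightarrow> g \<in> function_algebra V B \<Longrightarrow>
    (\<lambda>x. f x + g x) \<in> function_algebra V B"
| mult: "f \<in> function_algebra V B \<Longrightarrow> g \<in> function_algebra V B \<Longrightarrow>
    (\<lambda>x. f x * g x) \<in> function_algebra V B"
| inverse: "g \<in> function_algebra V B \<Longrightarrow> (\<And>x. x \<in> V \<Longrightarrow> g x \<noteq> 0) \<Longrightarrow>
    (\<lambda>x. inverse (g x)) \<in> function_algebra V B"
| flat: "g \<in> function_algebra V B \<Longrightarrow> (\<lambda>x. flat n (g x)) \<in> function_algebra V B"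

lemma function_algebra_sum:
  "finite J \<Longrightarrow> (\<And>j. j \<in> J \<Longrightarrow> g j \<in> function_algebra V B) \<Longrightarrow>
    (\<lambda>x. \<Sum>j\<in>J. g j x) \<in> function_algebra V B"
  by (induction J rule: finite_induct) (auto intro: function_algebra.intros)

text \<open>
  By the product, quotient and chain rules it suffices to know the partial derivatives of the
  generators. This is how an implicitly defined function is seen to be smooth: its first
  derivatives are expressed by the function itself.
\<close>

lemma function_algebra_partials:
  assumes B: "\<And>g. g \<in> B \<Longrightarrow> \<exists>d. (\<forall>j\<in>J. d j \<in> function_algebra V B) \<and>
      (\<forall>x\<in>V. (g has_derivative (\<lambda>h. \<Sum>j\<in>J. d j x * l j h)) (at x within V))"
    and "g \<in> function_algebra V B"
  shows "\<exists>d. (\<forall>j\<in>J. d j \<in> function_algebra V B) \<and>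
      (\<forall>x\<in>V. (g has_derivative (\<lambda>h. \<Sum>j\<in>J. d j x * l j h)) (at x within V))"
  using assms(2)
proof induction
  case (base g)
  then show ?case by (rule B)
next
  case (const c)
  show ?case
    by (intro exI[of _ "\<lambda>j x. 0"]) (auto intro: function_algebra.const)
next
  case (add f g)
  from this(3,4) obtain d e where
    d: "\<And>j. j \<in> J \<Longrightarrow> d j \<in> function_algebra V B"
      "\<And>x. x \<in> V \<Longrightarrow> (f has_derivative (\<lambda>h. \<Sum>j\<in>J. d j x * l j h)) (at x within V)" and
    e: "\<And>j. j \<in> J \<Longrightarrow> e j \<in> function_algebra V B"
      "\<And>x. x \<in> V \<Longrightarrow> (g has_derivative (\<lambda>h. \<Sum>j\<in>J. e j x * l j h)) (at x within V)"
    by blast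
  show ?case
  proof (intro exI[of _ "\<lambda>j x. d j x + e j x"] conjI ballI)
    show "((\<lambda>x. f x + g x) has_derivative (\<lambda>h. \<Sum>j\<in>J. (d j x + e j x) * l j h)) (at x within V)"
      if "x \<in> V" for x
      using has_derivative_add[OF d(2) e(2), OF that that] by (simp add: ring_distribs sum.distrib)
  qed (intro function_algebra.add d(1) e(1); assumption)
next
  case (mult f g)
  from this(3,4) obtain d e where
    d: "\<And>j. j \<in> J \<Longrightarrow> d j \<in> function_algebra V B"
      "\<And>x. x \<in> V \<Longrightarrow> (f has_derivative (\<lambda>h. \<Sum>j\<in>J. d j x * l j h)) (at x within V)" and
    e: "\<And>j. j \<in> J \<Longrightarrow> e j \<in> function_algebra V B"
      "\<And>x. x \<in> V \<Longrightarrow> (g has_derivative (\<lambda>h. \<Sum>j\<in>J. e j x * l j h)) (at x within V)"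
    by blast
  show ?case
  proof (intro exI[of _ "\<lambda>j x. f x * e j x + d j x * g x"] conjI ballI)
    show "((\<lambda>x. f x * g x) has_derivative (\<lambda>h. \<Sum>j\<in>J. (f x * e j x + d j x * g x) * l j h))
        (at x within V)" if "x \<in> V" for x
      using has_derivative_mult[OF d(2) e(2), OF that that]
      by (simp add: ring_distribs sum.distrib sum_distrib_left sum_distrib_right mult_ac)
  qed (intro function_algebra.add function_algebra.mult d(1) e(1) mult.hyps; assumption)
next
  case (inverse g)
  from this(3) obtain d where
    d: "\<And>j. j \<in> J \<Longrightarrow> d j \<in> function_algebra V B"
      "\<And>x. x \<in> V \<Longrightarrow> (g has_derivative (\<lambda>h. \<Sum>j\<in>J. d j x * l j h)) (at x within V)"
    by blast
  show ?case
  proof (intro exI[of _ "\<lambda>j x. (- 1) * (d j x * (inverse (g x) * inverse (g x)))"] conjI ballI)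
    show "((\<lambda>x. inverse (g x)) has_derivative
        (\<lambda>h. \<Sum>j\<in>J. (- 1) * (d j x * (inverse (g x) * inverse (g x))) * l j h)) (at x within V)"
      if "x \<in> V" for x
      using Deriv.has_derivative_inverse[OF inverse.hyps(2)[OF that] d(2)[OF that]]
      by (simp add: sum_distrib_left sum_distrib_right sum_negf mult_ac)
    show "(\<lambda>x. (- 1) * (d j x * (inverse (g x) * inverse (g x)))) \<in> function_algebra V B"
      if "j \<in> J" for j
      by (intro function_algebra.const function_algebra.mult function_algebra.inverse
          d(1)[OF that] inverse.hyps)
  qed
next
  case (flat g n)
  from this(2) obtain d where
    d: "\<And>j. j \<in> J \<Longrightarrow> d j \<in> function_algebra V B"
      "\<And>x. x \<in> V \<Longrightarrow> (g has_derivative (\<lambda>h. \<Sum>j\<in>J. d j x * l j h)) (at x within V)"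
    by blast
  let ?c = "\<lambda>x. flat (n + 2) (g x) + (- real n) * flat (n + 1) (g x)"
  show ?case
  proof (intro exI[of _ "\<lambda>j x. ?c x * d j x"] conjI ballI)
    show "((\<lambda>x. flat n (g x)) has_derivative (\<lambda>h. \<Sum>j\<in>J. ?c x * d j x * l j h)) (at x within V)"
      if "x \<in> V" for x
      using has_derivative_compose[OF d(2)[OF that]
          flat_deriv[of n "g x", unfolded has_field_derivative_def]]
      by (simp add: sum_distrib_left sum_distrib_right mult_ac)
    show "(\<lambda>x. ?c x * d j x) \<in> function_algebra V B" if "j \<in> J" for j
      by (intro function_algebra.const function_algebra.add function_algebra.mult
          function_algebra.flat d(1)[OF that] flat.hyps)
  qed
qed

lemma closed_under_partials_function_algebra:
  assumes "finite J" "\<And>j. j \<in> J \<Longrightarrow> bounded_linear (l j)"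
    and B: "\<And>g. g \<in> B \<Longrightarrow> \<exists>d. (\<forall>j\<in>J. d j \<in> function_algebra V B) \<and>
      (\<forall>x\<in>V. (g has_derivative (\<lambda>h. \<Sum>j\<in>J. d j x * l j h)) (at x within V))"
  shows "\<exists>P. closed_under_partials V J l (function_algebra V B) P"
proof -
  have "\<forall>g\<in>function_algebra V B. \<exists>d. (\<forall>j\<in>J. d j \<in> function_algebra V B) \<and>
      (\<forall>x\<in>V. (g has_derivative (\<lambda>h. \<Sum>j\<in>J. d j x * l j h)) (at x within V))"
    using function_algebra_partials[OF B] by blast
  then obtain P where "\<forall>g\<in>function_algebra V B. (\<forall>j\<in>J. P g j \<in> function_algebra V B) \<and>
      (\<forall>x\<in>V. (g has_derivative (\<lambda>h. \<Sum>j\<in>J. P g j x * l j h)) (at x within V))"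
    by (rule bchoice[THEN exE])
  then have "closed_under_partials V J l (function_algebra V B) P"
    using assms(1,2) unfolding closed_under_partials_def by blast
  then show ?thesis by (rule exI[where x = P])
qed

text \<open>
  The Lipschitz condition turns the error in the expansion of \<open>\<Phi>\<close>, which is small compared with
  \<open>norm (z - z0) + \<bar>p z - p z0\<bar>\<close>, into one that is small compared with \<open>norm (z - z0)\<close>.
\<close>

lemma implicit_function_has_derivative:
  fixes p :: "'a::real_normed_vector \<Rightarrow> real" and \<Phi> :: "'a \<times> real \<Rightarrow> real"
  assumes z0: "z0 \<in> V"
    and lip: "\<And>z. z \<in> V \<Longrightarrow> \<bar>p z - p z0\<bar> \<le> C * norm (z - z0)"
    and const: "\<And>z. z \<in> V \<Longrightarrow> \<Phi> (z, p z) = c"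
    and der: "(\<Phi> has_derivative (\<lambda>(h, r). a h + b * r)) (at (z0, p z0))"
    and b: "b \<noteq> 0" and a: "bounded_linear a"
  shows "(p has_derivative (\<lambda>h. - (a h / b))) (at z0 within V)"
proof -
  define C' where "C' = 2 + \<bar>C\<bar>"
  have C': "C' > 0" by (simp add: C'_def)
  show ?thesis
    unfolding has_derivative_within_alt
  proof (intro conjI allI impI)
    show "bounded_linear (\<lambda>h. - (a h / b))"
      using bounded_linear_compose[OF bounded_linear_mult_right[of "- inverse b"] a]
      by (simp add: field_simps)
    fix e :: real assume e: "e > 0"
    define e' where "e' = e * \<bar>b\<bar> / C'"
    have "e' > 0" using e b C' by (simp add: e'_def)
    then obtain d where d: "d > 0" "\<And>w. norm (w - (z0, p z0)) < d \<Longrightarrow>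
        norm (\<Phi> w - \<Phi> (z0, p z0) - (case w - (z0, p z0) of (h, r) \<Rightarrow> a h + b * r))
          \<le> e' * norm (w - (z0, p z0))"
      using der unfolding has_derivative_within_alt by blast
    show "\<exists>d>0. \<forall>z\<in>V. norm (z - z0) < d \<longrightarrow>
        norm (p z - p z0 - - (a (z - z0) / b)) \<le> e * norm (z - z0)"
    proof (intro exI[of _ "d / C'"] conjI ballI impI)
      show "d / C' > 0" using d C' by simp
      fix z assume z: "z \<in> V" "norm (z - z0) < d / C'"
      have "norm ((z, p z) - (z0, p z0)) \<le> norm (z - z0) + \<bar>p z - p z0\<bar>"
        using norm_Pair_le[of "z - z0" "p z - p z0"] by simp
      also have "\<dots> \<le> norm (z - z0) + \<bar>C\<bar> * norm (z - z0)"
        using lip[OF z(1)] by (smt (verit) mult_right_mono norm_ge_zero)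
      also have "\<dots> \<le> C' * norm (z - z0)" by (simp add: C'_def algebra_simps)
      finally have n: "norm ((z, p z) - (z0, p z0)) \<le> C' * norm (z - z0)" .
      also have "\<dots> < d" using z C' by (simp add: field_simps)
      finally have "\<bar>a (z - z0) + b * (p z - p z0)\<bar> \<le> e' * norm ((z, p z) - (z0, p z0))"
        using d(2)[of "(z, p z)"] const[OF z(1)] const[OF z0] by simp
      also have "\<dots> \<le> e' * (C' * norm (z - z0))"
        using n \<open>e' > 0\<close> by (simp add: mult_left_mono)
      also have "\<dots> = \<bar>b\<bar> * (e * norm (z - z0))" using C' by (simp add: e'_def)
      finally have "\<bar>b\<bar> * \<bar>p z - p z0 + a (z - z0) / b\<bar> \<le> \<bar>b\<bar> * (e * norm (z - z0))"
        using b by (simp add: abs_mult[symmetric] distrib_left add.commute)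
      then show "norm (p z - p z0 - - (a (z - z0) / b)) \<le> e * norm (z - z0)" using b by simp
    qed
  qed
qed

text \<open>
  Implicit differentiation gives \<open>d j\<close>, the partial derivatives of the gauge \<open>p\<close>. Their common
  denominator \<open>S\<close> is positive, since some term of the sum is positive, and there the hinge has
  positive slope.
\<close>

lemma implicit_gauge_smooth:
  fixes p :: "'a::real_normed_vector \<Rightarrow> real" and l :: "'j \<Rightarrow> 'a \<Rightarrow> real"
  assumes J: "finite J" and lin: "\<And>j. j \<in> J \<Longrightarrow> bounded_linear (l j)"
    and c: "\<And>j. j \<in> J \<Longrightarrow> 0 \<le> c j"
    and lip: "\<And>z w. z \<in> V \<Longrightarrow> w \<in> V \<Longrightarrow> \<bar>p z - p w\<bar> \<le> C * norm (z - w)"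
    and pos: "\<And>z. z \<in> V \<Longrightarrow> 0 < p z"
    and eq: "\<And>z. z \<in> V \<Longrightarrow> (\<Sum>j\<in>J. c j * smooth_hinge (l j z / p z - 1)) = 1"
  shows "\<exists>A P. closed_under_partials V J l A P \<and> p \<in> A"
proof -
  define B where "B = insert p (l ` J)"
  define u where "u j z = l j z / p z - 1" for j z
  define S where "S z = (\<Sum>j\<in>J. c j * smooth_hinge' (u j z) * l j z)" for z
  define d where "d j z = c j * smooth_hinge' (u j z) * (p z * inverse (S z))" for j z
  have S_pos: "0 < S z" if z: "z \<in> V" for z
  proof -
    have l_pos: "0 < l j z" if "0 < u j z" for j
      using that pos[OF z] by (simp add: u_def field_simps)
    have nonneg: "0 \<le> c j * smooth_hinge' (u j z) * l j z" if "j \<in> J" for j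
      using that c l_pos[of j] smooth_hinge'_nonneg[of "u j z"] smooth_hinge'_eq_0[of "u j z"]
      by (cases "0 < u j z") auto
    obtain j where j: "j \<in> J" "c j * smooth_hinge (u j z) \<noteq> 0"
    proof (rule sum.not_neutral_contains_not_neutral)
      show "(\<Sum>j\<in>J. c j * smooth_hinge (u j z)) \<noteq> 0" using eq[OF z] by (simp add: u_def)
    qed
    then have "0 < u j z"
      using smooth_hinge_eq_0[of "u j z"] by (cases "0 < u j z") auto
    moreover have "0 < c j" using j c[of j] by (metis less_eq_real_def mult_eq_0_iff)
    ultimately have "0 < c j * smooth_hinge' (u j z) * l j z"
      by (intro mult_pos_pos smooth_hinge'_pos l_pos)
    also have "\<dots> \<le> S z"
      unfolding S_def by (rule member_le_sum) (use J j nonneg in auto)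
    finally show ?thesis .
  qed
  have deriv: "(p has_derivative (\<lambda>h. \<Sum>j\<in>J. d j z * l j h)) (at z within V)" if z: "z \<in> V" for z
  proof -
    define \<Phi> where "\<Phi> w = (\<Sum>j\<in>J. c j * smooth_hinge (l j (fst w) / snd w - 1))" for w
    define a where "a h = (\<Sum>j\<in>J. c j * (smooth_hinge' (u j z) * (l j h / p z)))" for h
    define b where "b = - S z / (p z)\<^sup>2"
    have inner: "((\<lambda>w. l j (fst w) / snd w - 1) has_derivative
        (\<lambda>w. l j (fst w) / p z - l j z * snd w / (p z)\<^sup>2)) (at (z, p z))" if "j \<in> J" for j
    proof -
      have "((\<lambda>w. l j (fst w)) has_derivative (\<lambda>w. l j (fst w))) (at (z, p z))"
        by (rule bounded_linear.has_derivative[OF lin[OF that]]) (intro derivative_intros)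
      then have "((\<lambda>w. l j (fst w) / snd w) has_derivative
          (\<lambda>w. - l j z * (inverse (p z) * snd w * inverse (p z)) + l j (fst w) / p z))
          (at (z, p z))"
        using pos[OF z]
          has_derivative_divide[of "\<lambda>w. l j (fst w)" "\<lambda>w. l j (fst w)" "(z, p z)" UNIV snd snd]
        by (simp add: has_derivative_snd[OF has_derivative_ident])
      moreover have "- l j z * (inverse (p z) * r * inverse (p z)) + l j h / p z =
          l j h / p z - l j z * r / (p z)\<^sup>2" for h r
        using pos[OF z] by (simp add: divide_simps power2_eq_square)
      ultimately have "((\<lambda>w. l j (fst w) / snd w) has_derivative
          (\<lambda>w. l j (fst w) / p z - l j z * snd w / (p z)\<^sup>2)) (at (z, p z))"
        by simp
      from has_derivative_diff[OF this has_derivative_const[of 1]] show ?thesis by simp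
    qed
    have "(\<Phi> has_derivative (\<lambda>w. \<Sum>j\<in>J. c j *
        (smooth_hinge' (u j z) * (l j (fst w) / p z - l j z * snd w / (p z)\<^sup>2)))) (at (z, p z))"
      unfolding \<Phi>_def
    proof (intro has_derivative_sum has_derivative_mult_right)
      fix j assume "j \<in> J"
      have "(smooth_hinge has_derivative (*) (smooth_hinge' (u j z)))
          (at (l j (fst (z, p z)) / snd (z, p z) - 1))"
        using smooth_hinge_deriv[of "u j z"] by (simp add: has_field_derivative_def u_def)
      from has_derivative_compose[OF inner[OF \<open>j \<in> J\<close>] this]
      show "((\<lambda>w. smooth_hinge (l j (fst w) / snd w - 1)) has_derivative
          (\<lambda>w. smooth_hinge' (u j z) * (l j (fst w) / p z - l j z * snd w / (p z)\<^sup>2)))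
          (at (z, p z))" .
    qed
    moreover have "(\<Sum>j\<in>J. c j *
        (smooth_hinge' (u j z) * (l j h / p z - l j z * r / (p z)\<^sup>2))) = a h + b * r" for h r
      by (simp add: a_def b_def S_def right_diff_distrib sum_subtractf sum_distrib_right
          sum_distrib_left sum_divide_distrib sum_negf mult_ac)
    ultimately have "(\<Phi> has_derivative (\<lambda>(h, r). a h + b * r)) (at (z, p z))"
      by (simp add: case_prod_unfold)
    moreover have "bounded_linear a"
      unfolding a_def
      by (intro bounded_linear_sum bounded_linear_const_mult bounded_linear_compose[OF bounded_linear_divide] lin)
    moreover have "b \<noteq> 0" using S_pos[OF z] pos[OF z] by (simp add: b_def)
    ultimately have "(p has_derivative (\<lambda>h. - (a h / b))) (at z within V)"
      by (intro implicit_function_has_derivative[where \<Phi> = \<Phi> and c = 1 and C = C])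
         (use z lip eq in \<open>auto simp: \<Phi>_def\<close>)
    moreover have "- (a h / b) = (\<Sum>j\<in>J. d j z * l j h)" for h
      using S_pos[OF z] pos[OF z]
      by (simp add: a_def b_def d_def sum_divide_distrib sum_distrib_right sum_distrib_left
          field_simps power2_eq_square)
    ultimately show ?thesis by simp
  qed
  have p_in: "p \<in> function_algebra V B" and l_in: "\<And>j. j \<in> J \<Longrightarrow> l j \<in> function_algebra V B"
    by (auto simp: B_def intro: function_algebra.base)
  have u_in: "u j \<in> function_algebra V B" if "j \<in> J" for j
  proof -
    have "(\<lambda>z. l j z * inverse (p z) + - 1) \<in> function_algebra V B"
      using pos by (intro function_algebra.add function_algebra.mult function_algebra.inverse
          function_algebra.const l_in that p_in) fastforce
    then show ?thesis by (simp add: u_def[abs_def] divide_inverse)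
  qed
  have hinge_in: "(\<lambda>z. c j * smooth_hinge' (u j z)) \<in> function_algebra V B" if "j \<in> J" for j
    unfolding smooth_hinge'_def
    by (intro function_algebra.const function_algebra.mult function_algebra.add
        function_algebra.flat u_in that)
  have "S \<in> function_algebra V B"
    unfolding S_def[abs_def]
    by (intro function_algebra_sum J function_algebra.mult[OF hinge_in] l_in)
  then have d_in: "d j \<in> function_algebra V B" if "j \<in> J" for j
    unfolding d_def[abs_def] using S_pos that
    by (intro function_algebra.mult[OF hinge_in] function_algebra.mult[OF p_in]
        function_algebra.inverse) fastforce+
  have "\<exists>P. closed_under_partials V J l (function_algebra V B) P"
  proof (rule closed_under_partials_function_algebra[OF J lin])
    fix g assume "g \<in> B"
    then consider "g = p" | j where "j \<in> J" "g = l j" by (auto simp: B_def)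
    then show "\<exists>d. (\<forall>j\<in>J. d j \<in> function_algebra V B) \<and>
        (\<forall>x\<in>V. (g has_derivative (\<lambda>h. \<Sum>j\<in>J. d j x * l j h)) (at x within V))"
    proof cases
      case 1
      then show ?thesis using d_in deriv by (intro exI[of _ d]) blast
    next
      case (2 i)
      have "(\<lambda>h. \<Sum>j\<in>J. (if j = i then 1 else 0) * l j h) = l i"
        using 2 J by (simp add: if_distrib[where f = "\<lambda>c. c * _"] cong: if_cong)
      then show ?thesis
        using 2 bounded_linear_imp_has_derivative[OF lin]
        by (intro exI[of _ "\<lambda>j x. if j = i then 1 else 0"])
           (auto intro: function_algebra.const)
    qed
  qed
  with p_in show ?thesis by blast
qed

section \<open>A lattice norm with levels of increasing precision\<close>

type_synonym 'l pair = "('l discrete \<Rightarrow>\<^sub>C real) \<times> ('l discrete \<Rightarrow>\<^sub>C real)"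

text \<open>
  As \<open>k\<close> grows, the weights tend to those of \<open>mixed_sup\<close>. The first weight is too small by the square
  of the amount by which the second is too large; so at any \<open>t\<close> with \<open>x t \<noteq> 0\<close> the second deviation
  prevails eventually.
\<close>

definition level :: "nat \<Rightarrow> 'l \<Rightarrow> 'l pair \<Rightarrow> real" where
  "level k t z = (1 - (1/4) ^ Suc k) * \<bar>coord (fst z) t\<bar> + (1/2 + (1/2) ^ Suc k) * \<bar>coord (snd z) t\<bar>"

text \<open>
  The value at \<open>1 + (1/4) ^ Suc k\<close> is \<open>2\<close>. As it is greater than \<open>1\<close>, no level can exceed a feasible
  radius by more than the factor \<open>1 + (1/4) ^ Suc k\<close>.
\<close>

definition penalty :: "nat \<Rightarrow> real \<Rightarrow> real" where
  "penalty k r = 2 / smooth_hinge ((1/4) ^ Suc k) * smooth_hinge (r - 1)"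

text \<open>
  The terms are nonnegative, so the bound on the finite partial sums expresses that the sum over
  all pairs converges to a value of at most \<open>1\<close>.
\<close>

definition feasible :: "real \<Rightarrow> 'l pair \<Rightarrow> bool" where
  "feasible r z \<longleftrightarrow> 0 < r \<and>
     (\<forall>J. finite J \<longrightarrow> (\<Sum>(k, t)\<in>J. penalty k (level k t z / r)) \<le> 1)"

definition lattice_norm :: "'l pair \<Rightarrow> real" where
  "lattice_norm z = Inf {r. feasible r z}"

definition mixed_sup :: "'l pair \<Rightarrow> real" where
  "mixed_sup z = (SUP t. \<bar>coord (fst z) t\<bar> + \<bar>coord (snd z) t\<bar> / 2)"

lemma penalty_coeff_pos: "0 < 2 / smooth_hinge ((1/4) ^ Suc k)"
  by (simp add: smooth_hinge_pos)

lemma penalty_nonneg: "0 \<le> penalty k r"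
  unfolding penalty_def
  by (intro mult_nonneg_nonneg smooth_hinge_nonneg less_imp_le[OF penalty_coeff_pos])

lemma penalty_eq_0: "r \<le> 1 \<Longrightarrow> penalty k r = 0"
  by (simp add: penalty_def smooth_hinge_eq_0)

lemma penalty_mono: "r \<le> s \<Longrightarrow> penalty k r \<le> penalty k s"
  unfolding penalty_def
  by (intro mult_left_mono smooth_hinge_mono less_imp_le[OF penalty_coeff_pos]) simp

lemma penalty_strict_mono: "r < s \<Longrightarrow> 1 < s \<Longrightarrow> penalty k r < penalty k s"
  unfolding penalty_def
  by (intro mult_strict_left_mono smooth_hinge_strict_mono penalty_coeff_pos) simp_all

lemma penalty_le_1:
  assumes "penalty k r \<le> 1"
  shows "r \<le> 1 + (1/4) ^ Suc k"
proof (rule ccontr)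
  let ?\<eta> = "(1/4) ^ Suc k :: real"
  assume "\<not> r \<le> 1 + ?\<eta>"
  then have "penalty k (1 + ?\<eta>) \<le> penalty k r" by (intro penalty_mono) simp
  moreover have "penalty k (1 + ?\<eta>) = 2"
    using smooth_hinge_pos[of ?\<eta>] by (simp add: penalty_def del: power_Suc)
  ultimately show False using assms by simp
qed

lemma penalty_convex:
  assumes "0 \<le> a" "0 \<le> b" "a + b = 1"
  shows "penalty k (a * r + b * s) \<le> a * penalty k r + b * penalty k s"
proof -
  have "a * r + b * s - 1 = a * (r - 1) + b * (s - 1)"
    using assms by (simp add: algebra_simps)
  then have "smooth_hinge (a * r + b * s - 1) \<le> a * smooth_hinge (r - 1) + b * smooth_hinge (s - 1)"
    using convex_smooth_hinge assms unfolding convex_on_def by force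
  from mult_left_mono[OF this less_imp_le[OF penalty_coeff_pos[of k]]]
  show ?thesis by (simp add: penalty_def distrib_left mult.left_commute del: power_Suc)
qed

lemma isCont_penalty: "isCont (penalty k) r"
  unfolding penalty_def[abs_def]
  by (intro continuous_intros isCont_o2[OF _ isCont_smooth_hinge])

lemma abs_coord_le: "\<bar>coord f t\<bar> \<le> norm f"
  using norm_bounded[of f] by (metis real_norm_def)

lemma abs_coord_fst_le: "\<bar>coord (fst z) t\<bar> \<le> norm z"
  using abs_coord_le[of "fst z" t] norm_fst_le[of "fst z" "snd z"] by simp

lemma abs_coord_snd_le: "\<bar>coord (snd z) t\<bar> \<le> norm z"
  using abs_coord_le[of "snd z" t] norm_snd_le[of "snd z" "fst z"] by simp

lemma norm_le_coord:
  assumes "\<And>t. \<bar>coord f t\<bar> \<le> b"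
  shows "norm f \<le> b"
proof (rule norm_bound)
  show "norm (apply_bcontfun f t) \<le> b" for t
    using assms[of "of_discrete t"] by (simp add: of_discrete_inverse)
qed

lemma bounded_linear_coord: "bounded_linear (\<lambda>f. coord f t)"
  by (rule bounded_linear_intro[where K = 1]) (use abs_coord_le in auto)

lemma level_nonneg: "0 \<le> level k t z"
  unfolding level_def
  by (intro add_nonneg_nonneg mult_nonneg_nonneg) (auto simp: power_le_one simp del: power_Suc)

lemma level_mono:
  assumes "\<bar>coord (fst w) t\<bar> \<le> \<bar>coord (fst z) t\<bar>" "\<bar>coord (snd w) t\<bar> \<le> \<bar>coord (snd z) t\<bar>"
  shows "level k t w \<le> level k t z"
  unfolding level_def
  by (intro add_mono mult_left_mono assms) (auto simp: power_le_one simp del: power_Suc)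

lemma level_scaleR: "level k t (a *\<^sub>R z) = \<bar>a\<bar> * level k t z"
  by (simp add: level_def abs_mult algebra_simps)

lemma level_add: "level k t (z + w) \<le> level k t z + level k t w"
proof -
  have "level k t (z + w) \<le>
      (1 - (1/4) ^ Suc k) * (\<bar>coord (fst z) t\<bar> + \<bar>coord (fst w) t\<bar>) +
      (1/2 + (1/2) ^ Suc k) * (\<bar>coord (snd z) t\<bar> + \<bar>coord (snd w) t\<bar>)"
    unfolding level_def
    by (intro add_mono mult_left_mono) (auto simp: power_le_one simp del: power_Suc)
  then show ?thesis by (simp add: level_def ring_distribs del: power_Suc)
qed

lemma level_le: "level k t z \<le> \<bar>coord (fst z) t\<bar> + \<bar>coord (snd z) t\<bar>"
proof -
  have "(1/2::real) ^ Suc k \<le> 1/2" by (simp add: power_le_one)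
  then show ?thesis
    unfolding level_def
    by (intro add_mono mult_left_le_one_le) (auto simp: power_le_one simp del: power_Suc)
qed

lemma level_le_norm: "level k t z \<le> 2 * norm z"
  using level_le[of k t z] abs_coord_fst_le[of z t] abs_coord_snd_le[of z t] by linarith

lemma level_lipschitz: "level k t z \<le> level k t w + 2 * norm (z - w)"
  using level_add[of k t w "z - w"] level_le_norm[of k t "z - w"] by simp

lemma level_eq:
  "level k t z = \<bar>coord (fst z) t\<bar> + \<bar>coord (snd z) t\<bar> / 2 +
     ((1/2) ^ Suc k * \<bar>coord (snd z) t\<bar> - (1/4) ^ Suc k * \<bar>coord (fst z) t\<bar>)"
  by (simp add: level_def algebra_simps)

lemma feasible_transfer:
  assumes "feasible r z" "0 < s" "\<And>k t. level k t w / s \<le> level k t z / r"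
  shows "feasible s w"
  unfolding feasible_def
proof (intro conjI allI impI)
  fix J :: "(nat \<times> 'a) set" assume "finite J"
  have "(\<Sum>(k, t)\<in>J. penalty k (level k t w / s)) \<le> (\<Sum>(k, t)\<in>J. penalty k (level k t z / r))"
    by (intro sum_mono) (auto intro: penalty_mono assms)
  also have "\<dots> \<le> 1" using assms(1) \<open>finite J\<close> by (simp add: feasible_def)
  finally show "(\<Sum>(k, t)\<in>J. penalty k (level k t w / s)) \<le> 1" .
qed (rule assms)

lemma feasible_up:
  assumes "feasible r z" "r \<le> s"
  shows "feasible s z"
  using assms(1)
proof (rule feasible_transfer)
  show "0 < s" using assms by (simp add: feasible_def)
  then show "level k t z / s \<le> level k t z / r" for k t
    using assms level_nonneg[of k t z] by (intro divide_left_mono) (auto simp: feasible_def)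
qed

lemma feasible_of_norm:
  assumes "2 * norm z \<le> r" "0 < r"
  shows "feasible r z"
proof -
  have "penalty k (level k t z / r) = 0" for k t
    by (rule penalty_eq_0) (use level_le_norm[of k t z] assms in simp)
  then show ?thesis by (simp add: feasible_def assms)
qed

text \<open>
  Convexity of the feasible set in its homogeneous form: \<open>(z + w) / (r + s)\<close> is a convex
  combination of \<open>z / r\<close> and \<open>w / s\<close>.
\<close>

lemma feasible_add:
  assumes r: "feasible r z" and s: "feasible s w"
  shows "feasible (r + s) (z + w)"
  unfolding feasible_def
proof (intro conjI allI impI)
  have rs: "0 < r" "0 < s" using assms by (auto simp: feasible_def)
  then show "0 < r + s" by simp
  fix J :: "(nat \<times> 'a) set" assume J: "finite J"
  let ?a = "r / (r + s)" and ?b = "s / (r + s)"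
  have ab: "0 \<le> ?a" "0 \<le> ?b" "?a + ?b = 1" using rs by (auto simp: add_divide_distrib[symmetric])
  have "penalty k (level k t (z + w) / (r + s)) \<le>
      ?a * penalty k (level k t z / r) + ?b * penalty k (level k t w / s)" for k t
  proof -
    have "level k t (z + w) / (r + s) \<le> ?a * (level k t z / r) + ?b * (level k t w / s)"
      using rs level_add[of k t z w] by (simp add: add_divide_distrib[symmetric] divide_right_mono)
    then show ?thesis
      using penalty_mono penalty_convex[OF ab] by (meson order_trans)
  qed
  then have "(\<Sum>(k, t)\<in>J. penalty k (level k t (z + w) / (r + s))) \<le>
      (\<Sum>(k, t)\<in>J. ?a * penalty k (level k t z / r) + ?b * penalty k (level k t w / s))"
    by (intro sum_mono) auto
  also have "\<dots> = ?a * (\<Sum>(k, t)\<in>J. penalty k (level k t z / r)) +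
      ?b * (\<Sum>(k, t)\<in>J. penalty k (level k t w / s))"
    by (simp add: case_prod_unfold sum.distrib sum_distrib_left)
  also have "\<dots> \<le> ?a * 1 + ?b * 1"
    using r s J ab by (intro add_mono mult_left_mono) (auto simp: feasible_def)
  also have "\<dots> = 1" using ab by simp
  finally show "(\<Sum>(k, t)\<in>J. penalty k (level k t (z + w) / (r + s))) \<le> 1" .
qed

lemma feasible_level_le:
  assumes "feasible r z"
  shows "level k t z \<le> (1 + (1/4) ^ Suc k) * r"
proof -
  have "(\<Sum>(k, t)\<in>{(k, t)}. penalty k (level k t z / r)) \<le> 1"
    using assms unfolding feasible_def by blast
  then have "level k t z / r \<le> 1 + (1/4) ^ Suc k" by (intro penalty_le_1) simp
  then show ?thesis using assms by (simp add: feasible_def pos_divide_le_eq del: power_Suc)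
qed

lemma bdd_below_feasible: "bdd_below {r. feasible r z}"
  by (rule bdd_belowI[of _ 0]) (auto simp: feasible_def)

lemma feasible_nonempty: "{r. feasible r z} \<noteq> {}"
  using feasible_of_norm[of z "2 * norm z + 1"] norm_ge_zero[of z] by (auto intro: add_nonneg_pos)

lemma lattice_norm_le: "feasible r z \<Longrightarrow> lattice_norm z \<le> r"
  unfolding lattice_norm_def by (rule cInf_lower) (auto intro: bdd_below_feasible)

lemma feasible_of_lattice_norm_less:
  assumes "lattice_norm z < r"
  shows "feasible r z"
  using cInf_lessD[OF feasible_nonempty assms[unfolded lattice_norm_def]]
  by (auto intro: feasible_up)

lemma lattice_norm_nonneg: "0 \<le> lattice_norm z"
  unfolding lattice_norm_def
  by (rule cInf_greatest[OF feasible_nonempty]) (auto simp: feasible_def)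

lemma lattice_norm_le_norm: "lattice_norm z \<le> 2 * norm z"
proof (rule dense_ge)
  fix r assume "2 * norm z < r"
  moreover from this have "0 < r" by (meson le_less_trans norm_ge_zero mult_nonneg_nonneg zero_le_numeral)
  ultimately show "lattice_norm z \<le> r" by (intro lattice_norm_le feasible_of_norm) auto
qed

text \<open>
  Each single level bounds the norm from below. Level \<open>0\<close> shows that the norm is equivalent to the
  given one; the levels with large \<open>k\<close> are those needed on \<open>U_set L\<close>.
\<close>

lemma level_le_lattice_norm: "level k t z \<le> (1 + (1/4) ^ Suc k) * lattice_norm z"
proof -
  have "level k t z / (1 + (1/4) ^ Suc k) \<le> lattice_norm z"
  proof (rule dense_ge)
    fix r assume "lattice_norm z < r"
    then show "level k t z / (1 + (1/4) ^ Suc k) \<le> r"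
      using feasible_level_le[OF feasible_of_lattice_norm_less, of z r k t]
      by (simp add: pos_divide_le_eq add_pos_pos mult.commute del: power_Suc)
  qed
  then show ?thesis by (simp add: pos_divide_le_eq add_pos_pos mult.commute del: power_Suc)
qed

lemma norm_le_lattice_norm: "norm z \<le> 4 * lattice_norm z"
proof -
  have *: "3/4 * \<bar>coord (fst z) t\<bar> + \<bar>coord (snd z) t\<bar> \<le> 5/4 * lattice_norm z" for t
    using level_le_lattice_norm[of 0 t z] by (simp add: level_def)
  have "\<bar>coord (fst z) t\<bar> \<le> 2 * lattice_norm z" "\<bar>coord (snd z) t\<bar> \<le> 2 * lattice_norm z" for t
    using *[of t] lattice_norm_nonneg[of z] by (auto intro: order_trans)
  then have "norm (fst z) \<le> 2 * lattice_norm z" "norm (snd z) \<le> 2 * lattice_norm z"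
    by (auto intro: norm_le_coord)
  then show ?thesis using norm_Pair_le[of "fst z" "snd z"] by simp
qed

lemma lattice_norm_eq_0_iff: "lattice_norm z = 0 \<longleftrightarrow> z = 0"
  using norm_le_lattice_norm[of z] lattice_norm_le_norm[of z] lattice_norm_nonneg[of z] by auto

lemma lattice_norm_mono:
  assumes "\<And>t. \<bar>coord (fst w) t\<bar> \<le> \<bar>coord (fst z) t\<bar>" "\<And>t. \<bar>coord (snd w) t\<bar> \<le> \<bar>coord (snd z) t\<bar>"
  shows "lattice_norm w \<le> lattice_norm z"
proof (rule dense_ge)
  fix r assume "lattice_norm z < r"
  then have r: "feasible r z" by (rule feasible_of_lattice_norm_less)
  then have "feasible r w"
    by (rule feasible_transfer) (use r level_mono[OF assms] in \<open>auto simp: feasible_def intro: divide_right_mono\<close>)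
  then show "lattice_norm w \<le> r" by (rule lattice_norm_le)
qed

lemma lattice_norm_triangle: "lattice_norm (z + w) \<le> lattice_norm z + lattice_norm w"
proof (rule field_le_epsilon)
  fix e :: real assume "0 < e"
  then have "feasible ((lattice_norm z + e / 2) + (lattice_norm w + e / 2)) (z + w)"
    by (intro feasible_add feasible_of_lattice_norm_less) auto
  from lattice_norm_le[OF this] show "lattice_norm (z + w) \<le> lattice_norm z + lattice_norm w + e"
    by simp
qed

lemma lattice_norm_scaleR: "lattice_norm (a *\<^sub>R z) = \<bar>a\<bar> * lattice_norm z"
proof (cases "a = 0")
  case True
  then show ?thesis using lattice_norm_eq_0_iff[of "0 :: 'a pair"] by simp
next
  case False
  have le: "lattice_norm (a *\<^sub>R z) \<le> \<bar>a\<bar> * lattice_norm z" if "a \<noteq> 0" for a and z :: "'a pair"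
  proof -
    have "lattice_norm (a *\<^sub>R z) / \<bar>a\<bar> \<le> lattice_norm z"
    proof (rule dense_ge)
      fix r assume "lattice_norm z < r"
      then have r: "feasible r z" by (rule feasible_of_lattice_norm_less)
      then have "feasible (\<bar>a\<bar> * r) (a *\<^sub>R z)"
        by (rule feasible_transfer) (use r that in \<open>auto simp: feasible_def level_scaleR\<close>)
      then show "lattice_norm (a *\<^sub>R z) / \<bar>a\<bar> \<le> r"
        using lattice_norm_le that by (simp add: pos_divide_le_eq mult.commute)
    qed
    then show ?thesis using that by (simp add: pos_divide_le_eq mult.commute)
  qed
  have "lattice_norm z \<le> \<bar>inverse a\<bar> * lattice_norm (a *\<^sub>R z)"
    using le[of "inverse a" "a *\<^sub>R z"] False by simp
  then have "\<bar>a\<bar> * lattice_norm z \<le> lattice_norm (a *\<^sub>R z)"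
    using False by (simp add: abs_inverse field_simps)
  then show ?thesis using le[OF False, of z] by simp
qed

lemma lattice_norm_lipschitz: "\<bar>lattice_norm z - lattice_norm w\<bar> \<le> 2 * norm (z - w)"
proof -
  have "lattice_norm z - lattice_norm w \<le> 2 * norm (z - w)" for z w :: "'a pair"
    using lattice_norm_triangle[of "z - w" w] lattice_norm_le_norm[of "z - w"] by simp
  from this[of z w] this[of w z] show ?thesis by (simp add: norm_minus_commute)
qed

section \<open>The equation for the norm\<close>

lemma isCont_penalty_sum:
  assumes "0 < r"
  shows "isCont (\<lambda>r. \<Sum>(k, t)\<in>J. penalty k (level k t z / r)) r"
  unfolding case_prod_unfold
  by (intro continuous_intros isCont_o2[OF _ isCont_penalty]) (use assms in auto)

lemma feasible_lattice_norm:
  assumes "0 < lattice_norm z"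
  shows "feasible (lattice_norm z) z"
  unfolding feasible_def
proof (intro conjI allI impI assms)
  fix J :: "(nat \<times> 'a) set" assume J: "finite J"
  let ?F = "\<lambda>r. \<Sum>(k, t)\<in>J. penalty k (level k t z / r)"
  have "(?F \<longlongrightarrow> ?F (lattice_norm z)) (at_right (lattice_norm z))"
    using isCont_penalty_sum[OF assms] unfolding isCont_def by (rule tendsto_within_subset) simp
  moreover have "\<forall>\<^sub>F r in at_right (lattice_norm z). ?F r \<le> 1"
    using eventually_at_right_less[of "lattice_norm z"]
    by (rule eventually_mono) (use J in \<open>auto dest!: feasible_of_lattice_norm_less simp: feasible_def\<close>)
  ultimately show "?F (lattice_norm z) \<le> 1"
    by (rule tendsto_upperbound) simp
qed

text \<open>
  If the sum at \<open>lattice_norm z\<close> were smaller than \<open>1\<close>, a slightly smaller radius would be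
  feasible, since the pairs outside \<open>J\<close> do not contribute there either.
\<close>

lemma active_sum_eq_1:
  assumes J: "finite J" and pos: "0 < lattice_norm z" and c: "c < lattice_norm z"
    and inactive: "\<And>k t. (k, t) \<notin> J \<Longrightarrow> level k t z \<le> c"
  shows "(\<Sum>(k, t)\<in>J. penalty k (level k t z / lattice_norm z)) = 1"
proof (rule ccontr)
  let ?F = "\<lambda>r. \<Sum>(k, t)\<in>J. penalty k (level k t z / r)"
  assume "?F (lattice_norm z) \<noteq> 1"
  then have less: "?F (lattice_norm z) < 1"
    using feasible_lattice_norm[OF pos] J by (auto simp: feasible_def less_le)
  have "(?F \<longlongrightarrow> ?F (lattice_norm z)) (at_left (lattice_norm z))"
    using isCont_penalty_sum[OF pos] unfolding isCont_def by (rule tendsto_within_subset) simp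
  from order_tendstoD(2)[OF this less]
  have "\<forall>\<^sub>F r in at_left (lattice_norm z). ?F r < 1" .
  moreover have "\<forall>\<^sub>F r in at_left (lattice_norm z). r \<in> {max c 0<..<lattice_norm z}"
    using c pos by (intro eventually_at_left_real) simp
  ultimately have "\<forall>\<^sub>F r in at_left (lattice_norm z). ?F r < 1 \<and> r \<in> {max c 0<..<lattice_norm z}"
    by (rule eventually_conj)
  from eventually_happens'[OF trivial_limit_at_left_real this] obtain r
    where r: "?F r < 1" "c < r" "0 < r" "r < lattice_norm z" by auto
  have "feasible r z"
    unfolding feasible_def
  proof (intro conjI allI impI \<open>0 < r\<close>)
    fix K :: "(nat \<times> 'a) set" assume K: "finite K"
    have "(\<Sum>(k, t)\<in>K. penalty k (level k t z / r)) = (\<Sum>(k, t)\<in>K \<inter> J. penalty k (level k t z / r))"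
    proof (rule sum.mono_neutral_right[OF K])
      show "\<forall>i\<in>K - K \<inter> J. (case i of (k, t) \<Rightarrow> penalty k (level k t z / r)) = 0"
        using r inactive by (fastforce intro!: penalty_eq_0 simp: divide_le_eq_1)
    qed simp
    also have "\<dots> \<le> ?F r"
      by (intro sum_mono2 J) (auto simp: penalty_nonneg)
    finally show "(\<Sum>(k, t)\<in>K. penalty k (level k t z / r)) \<le> 1" using r by simp
  qed
  from lattice_norm_le[OF this] r show False by simp
qed

text \<open>The sum decreases strictly in the radius as long as it is positive.\<close>

lemma penalty_sum_inj:
  assumes J: "finite J" and rs: "0 < r" "0 < s"
    and r: "(\<Sum>(k, t)\<in>J. penalty k (level k t z / r)) = 1"
    and s: "(\<Sum>(k, t)\<in>J. penalty k (level k t z / s)) = 1"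
  shows "r = s"
proof -
  have "\<not> r < s" if rs: "0 < r" "0 < s" and r: "(\<Sum>(k, t)\<in>J. penalty k (level k t z / r)) = 1"
    and s: "(\<Sum>(k, t)\<in>J. penalty k (level k t z / s)) = 1" for r s
  proof
    assume "r < s"
    have le: "level k t z / s \<le> level k t z / r" for k t
      using \<open>r < s\<close> rs level_nonneg[of k t z] by (intro divide_left_mono) auto
    from s obtain k t where kt: "(k, t) \<in> J" "penalty k (level k t z / s) \<noteq> 0"
      by (metis (no_types, lifting) case_prodE2 old.prod.exhaust split_conv sum.neutral zero_neq_one)
    then have "1 < level k t z / s" using penalty_eq_0 by (meson not_le)
    then have "level k t z / s < level k t z / r" "1 < level k t z / r"
      using \<open>r < s\<close> rs by (auto simp: field_simps)
    then have "penalty k (level k t z / s) < penalty k (level k t z / r)"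
      by (rule penalty_strict_mono)
    then have "(\<Sum>(k, t)\<in>J. penalty k (level k t z / s)) < (\<Sum>(k, t)\<in>J. penalty k (level k t z / r))"
      using kt J le
      by (intro sum_strict_mono_ex1 bexI[of _ "(k, t)"]) (auto intro: penalty_mono)
    then show False using r s by simp
  qed
  from this[OF rs r s] this[OF rs(2,1) s r] show ?thesis by simp
qed

section \<open>Finitely many active levels\<close>

lemma bdd_above_mixed: "bdd_above (range (\<lambda>t. \<bar>coord (fst z) t\<bar> + \<bar>coord (snd z) t\<bar> / 2))"
proof (rule bdd_aboveI2)
  show "\<bar>coord (fst z) t\<bar> + \<bar>coord (snd z) t\<bar> / 2 \<le> norm (fst z) + norm (snd z)" for t
    using abs_coord_le[of "fst z" t] abs_coord_le[of "snd z" t] by simp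
qed

lemma mixed_le: "\<bar>coord (fst z) t\<bar> + \<bar>coord (snd z) t\<bar> / 2 \<le> mixed_sup z"
  unfolding mixed_sup_def by (rule cSUP_upper[OF _ bdd_above_mixed]) simp

lemma mixed_sup_lipschitz: "mixed_sup z \<le> mixed_sup w + 2 * norm (z - w)"
  unfolding mixed_sup_def[of z]
proof (rule cSUP_least)
  fix t
  have "\<bar>coord (fst z) t\<bar> \<le> \<bar>coord (fst w) t\<bar> + \<bar>coord (fst (z - w)) t\<bar>"
    "\<bar>coord (snd z) t\<bar> \<le> \<bar>coord (snd w) t\<bar> + \<bar>coord (snd (z - w)) t\<bar>"
    by simp_all
  moreover have "\<bar>coord (fst (z - w)) t\<bar> \<le> norm (z - w)" "\<bar>coord (snd (z - w)) t\<bar> \<le> norm (z - w)"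
    by (rule abs_coord_fst_le abs_coord_snd_le)+
  ultimately show "\<bar>coord (fst z) t\<bar> + \<bar>coord (snd z) t\<bar> / 2 \<le> mixed_sup w + 2 * norm (z - w)"
    using mixed_le[of w t] norm_ge_zero[of "z - w"] by linarith
qed simp

text \<open>
  Let \<open>v\<close> be the gap between \<open>mixed_sup z\<close> and \<open>norm (fst z)\<close>. Where the supremum is almost attained,
  the second coordinate is at least \<open>v\<close>. With \<open>h = (1/2) ^ Suc k\<close>, level \<open>k\<close> gains at least \<open>h * v\<close>
  there. If the norm were at most \<open>mixed_sup z\<close>, the loss and the tolerance would each be at most
  \<open>h * h * mixed_sup z\<close>, which is less than half of the gain if \<open>h\<close> is small.
\<close>

lemma mixed_sup_less_lattice_norm:
  assumes "norm (fst z) < mixed_sup z"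
  shows "mixed_sup z < lattice_norm z"
proof (rule ccontr)
  assume "\<not> mixed_sup z < lattice_norm z"
  then have le: "lattice_norm z \<le> mixed_sup z" by simp
  let ?M = "mixed_sup z"
  define v where "v = ?M - norm (fst z)"
  have v: "0 < v" using assms by (simp add: v_def)
  have M: "0 < ?M" using assms norm_ge_zero[of "fst z"] by linarith
  obtain k where k: "(1/2) ^ k < v / (2 * ?M)"
    using real_arch_pow_inv[of "v / (2 * ?M)" "1/2"] v M by auto
  define h :: real where "h = (1/2) ^ Suc k"
  have h: "0 < h" by (simp add: h_def)
  have h2: "(1/4::real) ^ Suc k = h * h"
    unfolding h_def power_mult_distrib[symmetric] by simp
  have "h \<le> (1/2) ^ k" by (simp add: h_def)
  then have "h < v / (2 * ?M)" using k by simp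
  then have "h * (2 * ?M) < v" using M by (simp add: field_simps)
  then have "h * (h * (2 * ?M)) < h * v" using h by simp
  \<comment> \<open>At a \<open>t\<close> that attains the supremum up to \<open>v / 2\<close>, the second coordinate is at least \<open>v\<close>.\<close>
  define e where "e = min (v / 2) (h * v - h * (h * (2 * ?M)))"
  have "0 < e" using \<open>h * (h * (2 * ?M)) < h * v\<close> v by (simp add: e_def)
  then have "?M - e < (SUP t. \<bar>coord (fst z) t\<bar> + \<bar>coord (snd z) t\<bar> / 2)"
    by (simp add: mixed_sup_def)
  then obtain t where t: "?M - e < \<bar>coord (fst z) t\<bar> + \<bar>coord (snd z) t\<bar> / 2"
    unfolding less_cSUP_iff[OF UNIV_not_empty bdd_above_mixed] by blast
  have f: "\<bar>coord (fst z) t\<bar> \<le> ?M - v" using abs_coord_le by (simp add: v_def)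
  have x: "v \<le> \<bar>coord (snd z) t\<bar>" using t f by (simp add: e_def)
  have "?M - e + h * v - h * h * ?M
      < \<bar>coord (fst z) t\<bar> + \<bar>coord (snd z) t\<bar> / 2 +
        (h * \<bar>coord (snd z) t\<bar> - h * h * \<bar>coord (fst z) t\<bar>)"
  proof -
    have "h * v \<le> h * \<bar>coord (snd z) t\<bar>" "h * h * \<bar>coord (fst z) t\<bar> \<le> h * h * ?M"
      using x f h v by (auto intro: mult_left_mono)
    then show ?thesis using t by linarith
  qed
  also have "\<dots> = level k t z" unfolding level_eq h2 h_def[symmetric] ..
  also have "\<dots> \<le> (1 + h * h) * lattice_norm z"
    using level_le_lattice_norm[of k t z] unfolding h2 .
  also have "\<dots> \<le> (1 + h * h) * ?M" using le by (intro mult_left_mono) auto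
  finally have "h * v - h * (h * (2 * ?M)) < e" by (simp add: algebra_simps)
  then show False by (simp add: e_def)
qed

lemma level_le_mixed: "level k t z \<le> mixed_sup z + (1/2) ^ Suc k * \<bar>coord (snd z) t\<bar>"
proof -
  have "0 \<le> (1/4) ^ Suc k * \<bar>coord (fst z) t\<bar>" by simp
  then show ?thesis unfolding level_eq using mixed_le[of z t] by linarith
qed

lemma active_nonzero:
  assumes "c < level k t z" "norm (snd z) \<le> mixed_sup z"
  shows "c - mixed_sup z < \<bar>coord (fst z) t\<bar>" "c - mixed_sup z < \<bar>coord (snd z) t\<bar>"
proof -
  show "c - mixed_sup z < \<bar>coord (fst z) t\<bar>"
    using level_le[of k t z] abs_coord_le[of "snd z" t] assms by linarith
  have "(1/2) ^ Suc k * \<bar>coord (snd z) t\<bar> \<le> \<bar>coord (snd z) t\<bar>"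
    by (intro mult_left_le_one_le) (auto simp: power_le_one simp del: power_Suc)
  then show "c - mixed_sup z < \<bar>coord (snd z) t\<bar>"
    using level_le_mixed[of k t z] assms by linarith
qed

text \<open>
  An active level needs \<open>(1/2) ^ Suc k * \<bar>x t\<bar>\<close> to exceed \<open>c - mixed_sup z\<close>. Since \<open>x\<close> is bounded, this
  leaves finitely many \<open>k\<close>; since \<open>x \<in> c_zero L\<close>, it leaves finitely many \<open>t\<close>.
\<close>

lemma finite_active:
  assumes z: "z \<in> direct_sum L" and c: "mixed_sup z < c"
  shows "finite {(k, t). c < level k t z}"
proof -
  define e where "e = c - mixed_sup z"
  have e: "0 < e" using c by (simp add: e_def)
  have n: "0 < norm (snd z) + 1" by (simp add: add_nonneg_pos)
  obtain n where n: "(1/2) ^ n < e / (norm (snd z) + 1)"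
    using real_arch_pow_inv[of "e / (norm (snd z) + 1)" "1/2"] e n by auto
  have "{(k, t). c < level k t z} \<subseteq> {..<n} \<times> {t \<in> L. e \<le> \<bar>coord (snd z) t\<bar>}"
  proof (rule subrelI)
    fix k t assume "(k, t) \<in> {(k, t). c < level k t z}"
    then have *: "e < (1/2) ^ Suc k * \<bar>coord (snd z) t\<bar>"
      using level_le_mixed[of k t z] by (simp add: e_def)
    also have "\<dots> \<le> (1/2) ^ Suc k * (norm (snd z) + 1)"
      by (intro mult_left_mono) (use abs_coord_le[of "snd z" t] in auto)
    finally have "e / (norm (snd z) + 1) < (1/2) ^ Suc k"
      using \<open>0 < norm (snd z) + 1\<close> by (simp add: pos_divide_less_eq)
    with n have "(1/2::real) ^ n < (1/2) ^ Suc k" by (rule less_trans)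
    then have "Suc k < n" by (subst (asm) power_strict_decreasing_iff) auto
    moreover have "(1/2) ^ Suc k * \<bar>coord (snd z) t\<bar> \<le> \<bar>coord (snd z) t\<bar>"
      by (intro mult_left_le_one_le) (auto simp: power_le_one simp del: power_Suc)
    then have "e \<le> \<bar>coord (snd z) t\<bar>" using * by simp
    moreover from this e have "t \<in> L"
      using z by (auto simp: direct_sum_def c_zero_def ell_infty_def)
    ultimately show "(k, t) \<in> {..<n} \<times> {t \<in> L. e \<le> \<bar>coord (snd z) t\<bar>}" by simp
  qed
  moreover have "finite {t \<in> L. e \<le> \<bar>coord (snd z) t\<bar>}"
    using z e by (auto simp: direct_sum_def c_zero_def)
  ultimately show ?thesis by (meson finite_SigmaI finite_lessThan finite_subset)
qed

section \<open>Local structure and smoothness of the norm\<close>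

lemma subspace_direct_sum: "subspace (direct_sum L)"
proof -
  have ell: "subspace (ell_infty L)"
    by (auto simp: subspace_def ell_infty_def)
  have "subspace (c_zero L)"
    unfolding subspace_def
  proof (intro conjI ballI allI)
    show "0 \<in> c_zero L" by (auto simp: c_zero_def ell_infty_def)
    fix x assume x: "x \<in> c_zero L"
    show "x + y \<in> c_zero L" if y: "y \<in> c_zero L" for y
      unfolding c_zero_def
    proof (intro CollectI conjI allI impI)
      show "x + y \<in> ell_infty L" using x y by (auto simp: c_zero_def ell_infty_def)
      fix e :: real assume "0 < e"
      then have "finite ({t \<in> L. e / 2 \<le> \<bar>coord x t\<bar>} \<union> {t \<in> L. e / 2 \<le> \<bar>coord y t\<bar>})"
        using x y half_gt_zero[of e] unfolding c_zero_def by blast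
      then show "finite {t \<in> L. e \<le> \<bar>coord (x + y) t\<bar>}"
        by (rule rev_finite_subset) auto
    qed
    show "a *\<^sub>R x \<in> c_zero L" for a
      unfolding c_zero_def
    proof (intro CollectI conjI allI impI)
      show "a *\<^sub>R x \<in> ell_infty L" using x by (auto simp: c_zero_def ell_infty_def)
      fix e :: real assume e: "0 < e"
      have "finite {t \<in> L. e / (\<bar>a\<bar> + 1) \<le> \<bar>coord x t\<bar>}"
        using x e by (simp add: c_zero_def)
      then show "finite {t \<in> L. e \<le> \<bar>coord (a *\<^sub>R x) t\<bar>}"
      proof (rule rev_finite_subset, clarsimp simp: abs_mult)
        fix t assume "e \<le> \<bar>a\<bar> * \<bar>coord x t\<bar>"
        also have "\<dots> \<le> \<bar>coord x t\<bar> * (\<bar>a\<bar> + 1)" by (simp add: algebra_simps)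
        finally show "e / (\<bar>a\<bar> + 1) \<le> \<bar>coord x t\<bar>" by (simp add: pos_divide_le_eq)
      qed
    qed
  qed
  with ell show ?thesis unfolding direct_sum_def by (rule subspace_Times)
qed

lemma mem_U_set_iff:
  "z \<in> U_set L \<longleftrightarrow> z \<in> direct_sum L \<and> norm (fst z) < mixed_sup z \<and> norm (snd z) < mixed_sup z"
  by (cases z) (simp add: U_set_def mixed_sup_def)

lemma lattice_norm_pos:
  assumes "z \<in> U_set L"
  shows "0 < lattice_norm z"
proof -
  have "norm (fst z) < mixed_sup z" using assms by (simp add: mem_U_set_iff)
  then show ?thesis
    using mixed_sup_less_lattice_norm[of z] norm_ge_zero[of "fst z"] by linarith
qed

lemma openin_U_set:
  fixes L :: "'l set"
  shows "openin (top_of_set (direct_sum L)) (U_set L)"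
proof -
  have cont: "continuous_on UNIV (mixed_sup :: 'l pair \<Rightarrow> real)"
  proof (rule lipschitz_on_continuous_on[of 2])
    show "2-lipschitz_on UNIV (mixed_sup :: 'l pair \<Rightarrow> real)"
    proof (rule lipschitz_onI)
      fix z w :: "'l pair"
      show "dist (mixed_sup z) (mixed_sup w) \<le> 2 * dist z w"
        using mixed_sup_lipschitz[of z w] mixed_sup_lipschitz[of w z]
        by (simp add: dist_norm norm_minus_commute)
    qed simp
  qed
  have "open ({z. norm (fst z) < mixed_sup z} \<inter> {z :: 'l pair. norm (snd z) < mixed_sup z})"
    by (intro open_Int open_Collect_less continuous_intros cont)
  moreover have "U_set L = direct_sum L \<inter>
      ({z. norm (fst z) < mixed_sup z} \<inter> {z. norm (snd z) < mixed_sup z})"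
    by (auto simp: mem_U_set_iff)
  ultimately show ?thesis by (simp add: openin_open_Int)
qed

lemma sgn_eq_of_close:
  fixes a b :: real
  assumes "\<bar>b - a\<bar> < \<bar>a\<bar>"
  shows "sgn b = sgn a" "b \<noteq> 0"
  using assms by (auto simp: sgn_if)

text \<open>
  \<open>J\<close> consists of the levels that lie above the middle of the gap \<open>g\<close> between \<open>mixed_sup z0\<close> and the
  norm of \<open>z0\<close>. Levels and norm have Lipschitz constant \<open>2\<close>, so on the ball of radius \<open>g / 16\<close> they move
  by less than \<open>g / 8\<close>: the other levels stay below \<open>3/4\<close> of the gap and the norm stays above.
  The coordinates of \<open>z0\<close> that occur in \<open>J\<close> exceed \<open>g / 2\<close> in absolute value and cannot change sign.
\<close>

lemma local_description:
  assumes z0: "z0 \<in> U_set L"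
  obtains J d where "finite J" "snd ` J \<subseteq> L" "0 < d"
    "\<And>z k t. z \<in> U_set L \<Longrightarrow> norm (z - z0) < d \<Longrightarrow> (k, t) \<in> J \<Longrightarrow>
      sgn (coord (fst z) t) = sgn (coord (fst z0) t) \<and> coord (fst z) t \<noteq> 0 \<and>
      sgn (coord (snd z) t) = sgn (coord (snd z0) t) \<and> coord (snd z) t \<noteq> 0"
    "\<And>z. z \<in> U_set L \<Longrightarrow> norm (z - z0) < d \<Longrightarrow>
      (\<Sum>(k, t)\<in>J. penalty k (level k t z / lattice_norm z)) = 1"
proof -
  let ?M = "mixed_sup z0"
  define g where "g = lattice_norm z0 - ?M"
  define J where "J = {(k, t). ?M + g / 2 < level k t z0}"
  have E: "z0 \<in> direct_sum L" and f0: "norm (fst z0) < ?M" and x0: "norm (snd z0) < ?M"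
    using z0 by (auto simp: mem_U_set_iff)
  have g: "0 < g" using mixed_sup_less_lattice_norm[OF f0] by (simp add: g_def)
  have M: "0 < ?M" using f0 norm_ge_zero[of "fst z0"] by linarith
  have fin: "finite J" unfolding J_def using finite_active[OF E] g by simp
  have large: "g / 2 < \<bar>coord (fst z0) t\<bar>" "g / 2 < \<bar>coord (snd z0) t\<bar>" if "(k, t) \<in> J" for k t
    using active_nonzero[of "?M + g / 2" k t z0] that x0 by (auto simp: J_def)
  have JL: "snd ` J \<subseteq> L"
  proof clarify
    fix k t assume "(k, t) \<in> J"
    then have "coord (fst z0) t \<noteq> 0" using large(1)[of k t] g by auto
    then show "snd (k, t) \<in> L" using E by (auto simp: direct_sum_def ell_infty_def)
  qed
  show thesis
  proof (rule that[OF fin JL, of "g / 16"])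
    show "0 < g / 16" using g by simp
    fix z assume z: "z \<in> U_set L" "norm (z - z0) < g / 16"
    have diff: "\<bar>coord (fst z) t - coord (fst z0) t\<bar> < g / 16"
      "\<bar>coord (snd z) t - coord (snd z0) t\<bar> < g / 16" for t
      using abs_coord_fst_le[of "z - z0" t] abs_coord_snd_le[of "z - z0" t] z(2) by simp_all
    show "sgn (coord (fst z) t) = sgn (coord (fst z0) t) \<and> coord (fst z) t \<noteq> 0 \<and>
      sgn (coord (snd z) t) = sgn (coord (snd z0) t) \<and> coord (snd z) t \<noteq> 0" if "(k, t) \<in> J" for k t
    proof -
      have "\<bar>coord (fst z) t - coord (fst z0) t\<bar> < \<bar>coord (fst z0) t\<bar>"
        "\<bar>coord (snd z) t - coord (snd z0) t\<bar> < \<bar>coord (snd z0) t\<bar>"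
        using large[OF that] diff[of t] g by linarith+
      then show ?thesis using sgn_eq_of_close by blast
    qed
    have p: "lattice_norm z0 - g / 8 < lattice_norm z"
      using lattice_norm_lipschitz[of z z0] z(2) by linarith
    show "(\<Sum>(k, t)\<in>J. penalty k (level k t z / lattice_norm z)) = 1"
    proof (rule active_sum_eq_1[OF fin, where c = "?M + 3/4 * g"])
      show "0 < lattice_norm z" "?M + 3/4 * g < lattice_norm z"
        using p M g g_def by linarith+
      fix k t assume "(k, t) \<notin> J"
      then have "level k t z0 \<le> ?M + g / 2" by (simp add: J_def)
      then show "level k t z \<le> ?M + 3/4 * g"
        using level_lipschitz[of k t z z0] z(2) g by linarith
    qed
  qed
qed

text \<open>With the signs of the coordinates fixed, each level in \<open>J\<close> is a linear functional.\<close>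

lemma lattice_norm_locally_smooth:
  fixes z0 :: "'l pair"
  assumes z0: "z0 \<in> U_set L"
  shows "\<exists>V (J :: (nat \<times> 'l) set) l A P. openin (top_of_set (direct_sum L)) V \<and> z0 \<in> V \<and>
    closed_under_partials V J l A P \<and> lattice_norm \<in> A"
proof -
  obtain J d where J: "finite J" "snd ` J \<subseteq> L" "0 < d" and
    sgn: "\<And>z k t. z \<in> U_set L \<Longrightarrow> norm (z - z0) < d \<Longrightarrow> (k, t) \<in> J \<Longrightarrow>
      sgn (coord (fst z) t) = sgn (coord (fst z0) t) \<and> coord (fst z) t \<noteq> 0 \<and>
      sgn (coord (snd z) t) = sgn (coord (snd z0) t) \<and> coord (snd z) t \<noteq> 0" and
    eq: "\<And>z. z \<in> U_set L \<Longrightarrow> norm (z - z0) < d \<Longrightarrow>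
      (\<Sum>(k, t)\<in>J. penalty k (level k t z / lattice_norm z)) = 1"
    by (rule local_description[OF z0]) blast
  define V where "V = U_set L \<inter> ball z0 d"
  define l where "l j z = (1 - (1/4) ^ Suc (fst j)) * (sgn (coord (fst z0) (snd j)) * coord (fst z) (snd j)) +
      (1/2 + (1/2) ^ Suc (fst j)) * (sgn (coord (snd z0) (snd j)) * coord (snd z) (snd j))"
    for j :: "nat \<times> 'l" and z :: "'l pair"
  have mem: "z \<in> U_set L" "norm (z - z0) < d" if "z \<in> V" for z
    using that by (auto simp: V_def dist_norm norm_minus_commute)
  have lin: "bounded_linear (l j)" for j
    unfolding l_def
    by (intro bounded_linear_add bounded_linear_const_mult
        bounded_linear_compose[OF bounded_linear_coord] bounded_linear_fst bounded_linear_snd)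
  have level: "level (fst j) (snd j) z = l j z" if "z \<in> V" "j \<in> J" for j z
  proof -
    have "sgn (coord (fst z) (snd j)) = sgn (coord (fst z0) (snd j))"
      "sgn (coord (snd z) (snd j)) = sgn (coord (snd z0) (snd j))"
      using sgn[OF mem[OF that(1)], of "fst j" "snd j"] that(2) by auto
    then show ?thesis by (simp add: level_def l_def abs_sgn mult.commute)
  qed
  have "\<exists>A P. closed_under_partials V J l A P \<and> lattice_norm \<in> A"
  proof (rule implicit_gauge_smooth[where c = "\<lambda>j. 2 / smooth_hinge ((1/4) ^ Suc (fst j))" and C = 2])
    show "0 < lattice_norm z" if "z \<in> V" for z
      by (rule lattice_norm_pos[OF mem(1)[OF that]])
    show "(\<Sum>j\<in>J. 2 / smooth_hinge ((1/4) ^ Suc (fst j)) * smooth_hinge (l j z / lattice_norm z - 1)) = 1"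
      if "z \<in> V" for z
      using eq[OF mem[OF that]] level[OF that]
      by (simp add: case_prod_unfold penalty_def del: power_Suc cong: sum.cong)
  qed (use J lin lattice_norm_lipschitz less_imp_le[OF penalty_coeff_pos] in auto)
  moreover have "openin (top_of_set (direct_sum L)) V"
    unfolding V_def by (intro openin_Int_open openin_U_set open_ball)
  moreover have "z0 \<in> V" using z0 J by (simp add: V_def)
  ultimately show ?thesis by blast
qed

theorem theorem1:
  fixes L :: "'l set"
  shows "\<exists>p :: ('l discrete \<Rightarrow>\<^sub>C real) \<times> ('l discrete \<Rightarrow>\<^sub>C real) \<Rightarrow> real.
     equivalent_norm_on (direct_sum L) p \<and>
     (\<forall>f x g y. (f, x) \<in> direct_sum L \<longrightarrow> (g, y) \<in> direct_sum L \<longrightarrow>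
        (\<forall>t\<in>L. \<bar>coord g t\<bar> \<le> \<bar>coord f t\<bar>) \<longrightarrow> (\<forall>t\<in>L. \<bar>coord y t\<bar> \<le> \<bar>coord x t\<bar>) \<longrightarrow>
        p (g, y) \<le> p (f, x)) \<and>
     frechet_smooth_on (direct_sum L) (U_set L) p \<and>
     (\<forall>z0\<in>U_set L. \<exists>N V. finite N \<and> N \<subseteq> L \<and> openin (top_of_set (U_set L)) V \<and> z0 \<in> V \<and>
        (\<forall>f x g y. (f, x) \<in> V \<longrightarrow> (g, y) \<in> V \<longrightarrow>
           (\<forall>t\<in>N. coord f t = coord g t \<and> coord x t = coord y t) \<longrightarrow> p (f, x) = p (g, y)) \<and>
        (\<forall>f x. (f, x) \<in> V \<longrightarrow> (\<forall>t\<in>N. coord f t \<noteq> 0 \<and> coord x t \<noteq> 0)))"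
proof (intro exI[of _ lattice_norm] conjI ballI allI impI)
  show "equivalent_norm_on (direct_sum L) lattice_norm"
    unfolding equivalent_norm_on_def norm_on_def
  proof (intro conjI ballI allI)
    show "\<exists>c>0. \<exists>C>0. \<forall>z\<in>direct_sum L. c * norm z \<le> lattice_norm z \<and> lattice_norm z \<le> C * norm z"
      using norm_le_lattice_norm lattice_norm_le_norm
      by (intro exI[of _ "1/4"] conjI exI[of _ 2] ballI) (auto simp: field_simps)
  qed (auto simp: lattice_norm_nonneg lattice_norm_eq_0_iff lattice_norm_scaleR
      lattice_norm_triangle)
next
  fix f x g y
  assume "(f, x) \<in> direct_sum L" "(g, y) \<in> direct_sum L"
    and "\<forall>t\<in>L. \<bar>coord g t\<bar> \<le> \<bar>coord f t\<bar>" "\<forall>t\<in>L. \<bar>coord y t\<bar> \<le> \<bar>coord x t\<bar>"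
  then have "\<bar>coord g t\<bar> \<le> \<bar>coord f t\<bar>" "\<bar>coord y t\<bar> \<le> \<bar>coord x t\<bar>" for t
    by (cases "t \<in> L"; simp add: direct_sum_def c_zero_def ell_infty_def)+
  then show "lattice_norm (g, y) \<le> lattice_norm (f, x)"
    by (intro lattice_norm_mono) simp_all
next
  show "frechet_smooth_on (direct_sum L) (U_set L) lattice_norm"
    by (rule frechet_smooth_onI[OF subspace_direct_sum openin_U_set lattice_norm_locally_smooth])
next
  fix z0 assume z0: "z0 \<in> U_set L"
  obtain J d where J: "finite J" "snd ` J \<subseteq> L" "0 < d" and
    sgn: "\<And>z k t. z \<in> U_set L \<Longrightarrow> norm (z - z0) < d \<Longrightarrow> (k, t) \<in> J \<Longrightarrow>
      sgn (coord (fst z) t) = sgn (coord (fst z0) t) \<and> coord (fst z) t \<noteq> 0 \<and>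
      sgn (coord (snd z) t) = sgn (coord (snd z0) t) \<and> coord (snd z) t \<noteq> 0" and
    eq: "\<And>z. z \<in> U_set L \<Longrightarrow> norm (z - z0) < d \<Longrightarrow>
      (\<Sum>(k, t)\<in>J. penalty k (level k t z / lattice_norm z)) = 1"
    by (rule local_description[OF z0]) blast
  define V where "V = U_set L \<inter> ball z0 d"
  have mem: "z \<in> U_set L" "norm (z - z0) < d" if "z \<in> V" for z
    using that by (auto simp: V_def dist_norm norm_minus_commute)
  have pos: "0 < lattice_norm z" if "z \<in> V" for z
    by (rule lattice_norm_pos[OF mem(1)[OF that]])
  show "\<exists>N V. finite N \<and> N \<subseteq> L \<and> openin (top_of_set (U_set L)) V \<and> z0 \<in> V \<and>
        (\<forall>f x g y. (f, x) \<in> V \<longrightarrow> (g, y) \<in> V \<longrightarrow>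
           (\<forall>t\<in>N. coord f t = coord g t \<and> coord x t = coord y t) \<longrightarrow>
           lattice_norm (f, x) = lattice_norm (g, y)) \<and>
        (\<forall>f x. (f, x) \<in> V \<longrightarrow> (\<forall>t\<in>N. coord f t \<noteq> 0 \<and> coord x t \<noteq> 0))"
  proof (intro exI[of _ "snd ` J"] exI[of _ V] conjI allI impI)
    show "openin (top_of_set (U_set L)) V" by (simp add: V_def openin_open_Int)
    show "z0 \<in> V" using z0 J by (simp add: V_def)
    show "\<forall>t\<in>snd ` J. coord f t \<noteq> 0 \<and> coord x t \<noteq> 0" if "(f, x) \<in> V" for f x
      using sgn[OF mem[OF that]] by auto
    fix f x g y
    assume fx: "(f, x) \<in> V" and gy: "(g, y) \<in> V"
      and agree: "\<forall>t\<in>snd ` J. coord f t = coord g t \<and> coord x t = coord y t"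
    \<comment> \<open>The two norms solve the same equation, which has only one solution.\<close>
    have "level k t (g, y) = level k t (f, x)" if "(k, t) \<in> J" for k t
      using agree that by (force simp: level_def)
    then have "(\<Sum>(k, t)\<in>J. penalty k (level k t (f, x) / lattice_norm (g, y))) =
        (\<Sum>(k, t)\<in>J. penalty k (level k t (g, y) / lattice_norm (g, y)))"
      by (intro sum.cong) auto
    also have "\<dots> = 1" by (rule eq[OF mem[OF gy]])
    finally show "lattice_norm (f, x) = lattice_norm (g, y)"
      by (intro penalty_sum_inj[OF J(1) pos[OF fx] pos[OF gy] eq[OF mem[OF fx]]])
  qed (use J in auto)
qed

end
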